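(* Suppose that $\Phi$ is a regularity property such that $\Phi(F,B)$ implies that $F$ contains no uncountable antichain. Then every $\Phi$-c.c.\ poset satisfies the countable chain condition.
   Context: A \emph{regularity property} is a property $\Phi(F,B)$ of subsets $F$ of complete Boolean algebras $B$ such that ZFC proves: (1) $\Phi(\{1\},B)$ for every complete Boolean algebra $B$; (2) $\Phi(F,B)$ implies $\Phi(F',B)$ where $F'=\{p\in B\colon\exists q\in F\ q\leq p\}$; (3) for $p\in B$, $\Phi(F,B)$ implies $\Phi(F\cap(B\restriction p),B\restriction p)$, and $\Phi(F,B\restriction p)$ implies $\Phi(F,B)$, where $B\restriction p=\{q\in B\colon q\leq p\}$; (4) if $B_0$ is a complete subalgebra of $B_1$, then for $F\subset B_1$, $\Phi(F,B_1)$ implies $\Phi(F\cap B_0,B_0)$, and for $F\subset B_0$, $\Phi(F,B_0)$ implies $\Phi(F,B_1)$; (5) if $\dot B_1$ is a $B_0$-name for a complete Boolean algebra, $F_0\subset B_0$, $\dot F_1$ is a name for a subset of $\dot B_1$, $\Phi(F_0,B_0)$ and $1\Vdash\Phi(\dot F_1,\dot B_1)$, then $\Phi(F_0*\dot F_1,B_0*\dot B_1)$. Here $B_0*\dot B_1$ is the complete Boolean algebra obtained as the separative quotient (plus zero) of the poset of pairs $\langle p_0,\dot p_1\rangle$ with $0\neq p_0\in B_0$, $p_0\Vdash 0\neq\dot p_1\in\dot B_1$, ordered by $\langle q_0,\dot q_1\rangle\leq\langle p_0,\dot p_1\rangle$ iff $q_0\leq p_0$ and $q_0\Vdash\dot q_1\leq\dot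 p_1$; and $F_0*\dot F_1=\{\langle p_0,\dot p_1\rangle\colon p_0\wedge\|\dot p_1\in\dot F_1\|\in F_0\}$. A poset $P$ is \emph{$\Phi$-c.c.} if for every $q\in P$ and every countable elementary submodel $M\prec H_\theta$ ($\theta$ large regular) containing $P$ there is a set $F\in M$, $F\subset RO(P)$, with $\Phi(F,RO(P))$ and $F\supseteq\{p\in RO(P)\cap M\colon p\geq q\}$. $RO(P)$ is the completion of $P$. *)

theory Defs
  imports Main "HOL-Library.Countable_Set"
begin

unbundle cardinal_syntax

section \<open>First-order formulas of set theory\<close>

text \<open>
  A property of sets is a first-order formula in the language of membership; this is what makes
  it meaningful in other models of ZFC and in forcing extensions. Variables are named by numbers.
\<close>

datatype fm = Mem nat nat | Eq nat nat | Neg fm | And fm fm | All nat fm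

primrec fv :: "fm \<Rightarrow> nat set" where
  "fv (Mem i j) = {i, j}"
| "fv (Eq i j) = {i, j}"
| "fv (Neg \<phi>) = fv \<phi>"
| "fv (And \<phi> \<psi>) = fv \<phi> \<union> fv \<psi>"
| "fv (All i \<phi>) = fv \<phi> - {i}"

text \<open>Satisfaction in the structure with domain \<open>D\<close> and the relation \<open>mem\<close> restricted to \<open>D\<close>.\<close>

primrec sat :: "('v \<Rightarrow> 'v \<Rightarrow> bool) \<Rightarrow> 'v set \<Rightarrow> (nat \<Rightarrow> 'v) \<Rightarrow> fm \<Rightarrow> bool" where
  "sat mem D e (Mem i j) \<longleftrightarrow> mem (e i) (e j)"
| "sat mem D e (Eq i j) \<longleftrightarrow> e i = e j"
| "sat mem D e (Neg \<phi>) \<longleftrightarrow> \<not> sat mem D e \<phi>"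
| "sat mem D e (And \<phi> \<psi>) \<longleftrightarrow> sat mem D e \<phi> \<and> sat mem D e \<psi>"
| "sat mem D e (All i \<phi>) \<longleftrightarrow> (\<forall>a\<in>D. sat mem D (e(i := a)) \<phi>)"

definition elementary :: "('v \<Rightarrow> 'v \<Rightarrow> bool) \<Rightarrow> 'v set \<Rightarrow> 'v set \<Rightarrow> bool" where
  "elementary mem M N \<longleftrightarrow> M \<noteq> {} \<and> M \<subseteq> N \<and>
     (\<forall>\<phi> e. range e \<subseteq> M \<longrightarrow> (sat mem M e \<phi> \<longleftrightarrow> sat mem N e \<phi>))"

text \<open>
  Formulas are written with the following combinators. A term of type \<open>nat \<Rightarrow> fm\<close> awaits a number
  \<open>n\<close> such that all variables \<open>\<ge> n\<close> are fresh; a quantifier binds the variable \<open>n\<close>.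
\<close>

definition hMem :: "nat \<Rightarrow> nat \<Rightarrow> nat \<Rightarrow> fm" (infix "\<^bold>\<in>" 50) where
  "(x \<^bold>\<in> y) n = Mem x y"
definition hEq :: "nat \<Rightarrow> nat \<Rightarrow> nat \<Rightarrow> fm" (infix "\<^bold>=" 50) where
  "(x \<^bold>= y) n = Eq x y"
definition hNot :: "(nat \<Rightarrow> fm) \<Rightarrow> nat \<Rightarrow> fm" ("\<^bold>\<not> _" [40] 40) where
  "(\<^bold>\<not> f) n = Neg (f n)"
definition hAnd :: "(nat \<Rightarrow> fm) \<Rightarrow> (nat \<Rightarrow> fm) \<Rightarrow> nat \<Rightarrow> fm" (infixr "\<^bold>\<and>" 35) where
  "(f \<^bold>\<and> g) n = And (f n) (g n)"
definition hAll :: "(nat \<Rightarrow> nat \<Rightarrow> fm) \<Rightarrow> nat \<Rightarrow> fm" (binder "\<^bold>\<forall>" 10) where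
  "hAll f n = All n (f n (Suc n))"
definition hOr :: "(nat \<Rightarrow> fm) \<Rightarrow> (nat \<Rightarrow> fm) \<Rightarrow> nat \<Rightarrow> fm" (infixr "\<^bold>\<or>" 30) where
  "(f \<^bold>\<or> g) = (\<^bold>\<not> (\<^bold>\<not> f \<^bold>\<and> \<^bold>\<not> g))"
definition hImp :: "(nat \<Rightarrow> fm) \<Rightarrow> (nat \<Rightarrow> fm) \<Rightarrow> nat \<Rightarrow> fm" (infixr "\<^bold>\<longrightarrow>" 25) where
  "(f \<^bold>\<longrightarrow> g) = (\<^bold>\<not> (f \<^bold>\<and> \<^bold>\<not> g))"
definition hIff :: "(nat \<Rightarrow> fm) \<Rightarrow> (nat \<Rightarrow> fm) \<Rightarrow> nat \<Rightarrow> fm" (infixr "\<^bold>\<longleftrightarrow>" 25) where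
  "(f \<^bold>\<longleftrightarrow> g) = ((f \<^bold>\<longrightarrow> g) \<^bold>\<and> (g \<^bold>\<longrightarrow> f))"
definition hEx :: "(nat \<Rightarrow> nat \<Rightarrow> fm) \<Rightarrow> nat \<Rightarrow> fm" (binder "\<^bold>\<exists>" 10) where
  "hEx f = (\<^bold>\<not> (\<^bold>\<forall>x. \<^bold>\<not> f x))"

lemma sat_h [simp]:
  "sat mem D e ((x \<^bold>\<in> y) n) \<longleftrightarrow> mem (e x) (e y)"
  "sat mem D e ((x \<^bold>= y) n) \<longleftrightarrow> e x = e y"
  "sat mem D e ((\<^bold>\<not> f) n) \<longleftrightarrow> \<not> sat mem D e (f n)"
  "sat mem D e ((f \<^bold>\<and> g) n) \<longleftrightarrow> sat mem D e (f n) \<and> sat mem D e (g n)"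
  "sat mem D e ((f \<^bold>\<or> g) n) \<longleftrightarrow> sat mem D e (f n) \<or> sat mem D e (g n)"
  "sat mem D e ((f \<^bold>\<longrightarrow> g) n) \<longleftrightarrow> (sat mem D e (f n) \<longrightarrow> sat mem D e (g n))"
  "sat mem D e ((f \<^bold>\<longleftrightarrow> g) n) \<longleftrightarrow> (sat mem D e (f n) \<longleftrightarrow> sat mem D e (g n))"
  "sat mem D e (hAll h n) \<longleftrightarrow> (\<forall>a\<in>D. sat mem D (e(n := a)) (h n (Suc n)))"
  "sat mem D e (hEx h n) \<longleftrightarrow> (\<exists>a\<in>D. sat mem D (e(n := a)) (h n (Suc n)))"
  by (auto simp: hMem_def hEq_def hNot_def hAnd_def hOr_def hImp_def hIff_def hAll_def hEx_def)

section \<open>ZFC\<close>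

locale membership =
  fixes mem :: "'v \<Rightarrow> 'v \<Rightarrow> bool" (infix "\<epsilon>" 50)
begin

definition separation_for :: "('v \<Rightarrow> bool) \<Rightarrow> bool" where
  "separation_for Q \<longleftrightarrow> (\<forall>a. \<exists>b. \<forall>x. x \<epsilon> b \<longleftrightarrow> x \<epsilon> a \<and> Q x)"

definition replacement_for :: "('v \<Rightarrow> 'v \<Rightarrow> bool) \<Rightarrow> bool" where
  "replacement_for R \<longleftrightarrow>
     (\<forall>a. (\<forall>x. x \<epsilon> a \<longrightarrow> (\<exists>!y. R x y)) \<longrightarrow> (\<exists>b. \<forall>y. y \<epsilon> b \<longleftrightarrow> (\<exists>x. x \<epsilon> a \<and> R x y)))"

definition finite_zfc_axioms :: bool where
  "finite_zfc_axioms \<longleftrightarrow>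
     (\<forall>x y. (\<forall>z. z \<epsilon> x \<longleftrightarrow> z \<epsilon> y) \<longrightarrow> x = y) \<and>
     (\<forall>x. (\<exists>y. y \<epsilon> x) \<longrightarrow> (\<exists>y. y \<epsilon> x \<and> \<not> (\<exists>z. z \<epsilon> x \<and> z \<epsilon> y))) \<and>
     (\<forall>x y. \<exists>z. \<forall>w. w \<epsilon> z \<longleftrightarrow> w = x \<or> w = y) \<and>
     (\<forall>x. \<exists>u. \<forall>z. z \<epsilon> u \<longleftrightarrow> (\<exists>y. y \<epsilon> x \<and> z \<epsilon> y)) \<and>
     (\<forall>x. \<exists>p. \<forall>y. y \<epsilon> p \<longleftrightarrow> (\<forall>z. z \<epsilon> y \<longrightarrow> z \<epsilon> x)) \<and>
     (\<exists>w. (\<exists>z. z \<epsilon> w \<and> (\<forall>y. \<not> y \<epsilon> z)) \<and>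
          (\<forall>x. x \<epsilon> w \<longrightarrow> (\<exists>s. s \<epsilon> w \<and> (\<forall>y. y \<epsilon> s \<longleftrightarrow> y \<epsilon> x \<or> y = x)))) \<and>
     (\<forall>a. (\<forall>x. x \<epsilon> a \<longrightarrow> (\<exists>y. y \<epsilon> x)) \<and>
          (\<forall>x y. x \<epsilon> a \<and> y \<epsilon> a \<and> x \<noteq> y \<longrightarrow> \<not> (\<exists>z. z \<epsilon> x \<and> z \<epsilon> y)) \<longrightarrow>
          (\<exists>c. \<forall>x. x \<epsilon> a \<longrightarrow> (\<exists>!y. y \<epsilon> x \<and> y \<epsilon> c)))"

text \<open>Models of first-order ZFC; the environment \<open>e\<close> supplies the parameters of the schemas.\<close>

definition zfc_model :: bool where
  "zfc_model \<longleftrightarrow> finite_zfc_axioms \<and>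
     (\<forall>\<phi> e. separation_for (\<lambda>x. sat mem UNIV (e(0 := x)) \<phi>)) \<and>
     (\<forall>\<phi> e. replacement_for (\<lambda>x y. sat mem UNIV (e(0 := x, 1 := y)) \<phi>))"

text \<open>
  The universe of sets of the ambient mathematics: classes are arbitrary predicates of the logic,
  so that subsets, functions and cardinalities of its elements are those of HOL.
\<close>

definition zfc_universe :: bool where
  "zfc_universe \<longleftrightarrow> finite_zfc_axioms \<and> (\<forall>Q. separation_for Q) \<and> (\<forall>R. replacement_for R)"

definition ext :: "'v \<Rightarrow> 'v set" where
  "ext a = {x. x \<epsilon> a}"

text \<open>\<open>setof Q\<close> is only meaningful if the class \<open>Q\<close> is a set.\<close>

definition setof :: "('v \<Rightarrow> bool) \<Rightarrow> 'v" where
  "setof Q = (THE s. \<forall>x. x \<epsilon> s \<longleftrightarrow> Q x)"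

section \<open>Posets and complete Boolean algebras as sets\<close>

text \<open>
  A poset is coded by its reflexive order relation, a set of Kuratowski pairs. Its elements are
  the \<open>x\<close> with \<open>(x, x)\<close> in the relation.
\<close>

definition is_upair :: "'v \<Rightarrow> 'v \<Rightarrow> 'v \<Rightarrow> bool" where
  "is_upair w x y \<longleftrightarrow> (\<forall>v. v \<epsilon> w \<longleftrightarrow> v = x \<or> v = y)"

definition is_pair :: "'v \<Rightarrow> 'v \<Rightarrow> 'v \<Rightarrow> bool" where
  "is_pair z x y \<longleftrightarrow> (\<forall>w. w \<epsilon> z \<longleftrightarrow> is_upair w x x \<or> is_upair w x y)"

definition opair :: "'v \<Rightarrow> 'v \<Rightarrow> 'v" where
  "opair x y = (THE z. is_pair z x y)"

definition le :: "'v \<Rightarrow> 'v \<Rightarrow> 'v \<Rightarrow> bool" where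
  "le B x y \<longleftrightarrow> (\<exists>z. z \<epsilon> B \<and> is_pair z x y)"

definition el :: "'v \<Rightarrow> 'v \<Rightarrow> bool" where
  "el B x \<longleftrightarrow> le B x x"

definition sub :: "'v \<Rightarrow> 'v \<Rightarrow> bool" where
  "sub F B \<longleftrightarrow> (\<forall>x. x \<epsilon> F \<longrightarrow> el B x)"

definition poset :: "'v \<Rightarrow> bool" where
  "poset P \<longleftrightarrow>
     (\<forall>z. z \<epsilon> P \<longrightarrow> (\<exists>x y. is_pair z x y)) \<and>
     (\<forall>x y. le P x y \<longrightarrow> el P x \<and> el P y) \<and>
     (\<forall>x y. le P x y \<and> le P y x \<longrightarrow> x = y) \<and>
     (\<forall>x y z. le P x y \<and> le P y z \<longrightarrow> le P x z)"

definition is_zero :: "'v \<Rightarrow> 'v \<Rightarrow> bool" where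
  "is_zero B x \<longleftrightarrow> el B x \<and> (\<forall>y. el B y \<longrightarrow> le B x y)"

definition is_one :: "'v \<Rightarrow> 'v \<Rightarrow> bool" where
  "is_one B x \<longleftrightarrow> el B x \<and> (\<forall>y. el B y \<longrightarrow> le B y x)"

definition is_lub :: "'v \<Rightarrow> 'v \<Rightarrow> 'v \<Rightarrow> bool" where
  "is_lub B S s \<longleftrightarrow> el B s \<and> (\<forall>x. x \<epsilon> S \<longrightarrow> le B x s) \<and>
     (\<forall>u. el B u \<and> (\<forall>x. x \<epsilon> S \<longrightarrow> le B x u) \<longrightarrow> le B s u)"

definition is_join :: "'v \<Rightarrow> 'v \<Rightarrow> 'v \<Rightarrow> 'v \<Rightarrow> bool" where
  "is_join B x y s \<longleftrightarrow> le B x s \<and> le B y s \<and> (\<forall>u. le B x u \<and> le B y u \<longrightarrow> le B s u)"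

definition is_meet :: "'v \<Rightarrow> 'v \<Rightarrow> 'v \<Rightarrow> 'v \<Rightarrow> bool" where
  "is_meet B x y m \<longleftrightarrow> le B m x \<and> le B m y \<and> (\<forall>u. le B u x \<and> le B u y \<longrightarrow> le B u m)"

definition is_compl :: "'v \<Rightarrow> 'v \<Rightarrow> 'v \<Rightarrow> bool" where
  "is_compl B x y \<longleftrightarrow>
     (\<exists>z. is_zero B z \<and> is_meet B x y z) \<and> (\<exists>t. is_one B t \<and> is_join B x y t)"

text \<open>
  Complete Boolean algebras are complete, distributive, complemented lattices with \<open>0 \<noteq> 1\<close>
  (meets exist because joins of arbitrary subsets do).
\<close>

definition cba :: "'v \<Rightarrow> bool" where
  "cba B \<longleftrightarrow> poset B \<and>
     (\<forall>S. sub S B \<longrightarrow> (\<exists>s. is_lub B S s)) \<and>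
     (\<forall>x y z j m a b k. is_join B y z j \<and> is_meet B x j m \<and>
        is_meet B x y a \<and> is_meet B x z b \<and> is_join B a b k \<longrightarrow> m = k) \<and>
     (\<forall>x. el B x \<longrightarrow> (\<exists>y. is_compl B x y)) \<and>
     \<not> (\<exists>x. is_zero B x \<and> is_one B x)"

definition nonzero :: "'v \<Rightarrow> 'v \<Rightarrow> bool" where
  "nonzero B p \<longleftrightarrow> el B p \<and> \<not> is_zero B p"

definition restrict :: "'v \<Rightarrow> 'v \<Rightarrow> 'v" where
  "restrict B p = setof (\<lambda>z. \<exists>x y. is_pair z x y \<and> le B x y \<and> le B y p)"

definition complete_subalgebra :: "'v \<Rightarrow> 'v \<Rightarrow> bool" where
  "complete_subalgebra C B \<longleftrightarrow> cba C \<and> cba B \<and>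
     (\<forall>x y. le C x y \<longleftrightarrow> el C x \<and> el C y \<and> le B x y) \<and>
     (\<forall>x. el C x \<longrightarrow> el B x) \<and>
     (\<forall>x y. el C x \<and> is_compl B x y \<longrightarrow> el C y) \<and>
     (\<forall>S s. sub S C \<and> is_lub B S s \<longrightarrow> el C s)"

definition up_closure :: "'v \<Rightarrow> 'v \<Rightarrow> 'v" where
  "up_closure B F = setof (\<lambda>p. el B p \<and> (\<exists>q. q \<epsilon> F \<and> le B q p))"

end

text \<open>
  The same notions as formulas, needed because regularity speaks about what is forced in a
  two-step iteration. Lemma \<open>sat_ba\<close> below shows that they say the same.
\<close>

definition "fupair w x y = (\<^bold>\<forall>v. v \<^bold>\<in> w \<^bold>\<longleftrightarrow> v \<^bold>= x \<^bold>\<or> v \<^bold>= y)"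
definition "fpair z x y = (\<^bold>\<forall>w. w \<^bold>\<in> z \<^bold>\<longleftrightarrow> fupair w x x \<^bold>\<or> fupair w x y)"
definition "fle B x y = (\<^bold>\<exists>z. z \<^bold>\<in> B \<^bold>\<and> fpair z x y)"
definition "fel B x = fle B x x"
definition "fsub F B = (\<^bold>\<forall>x. x \<^bold>\<in> F \<^bold>\<longrightarrow> fel B x)"
definition "fposet P =
  ((\<^bold>\<forall>z. z \<^bold>\<in> P \<^bold>\<longrightarrow> (\<^bold>\<exists>x y. fpair z x y)) \<^bold>\<and>
   (\<^bold>\<forall>x y. fle P x y \<^bold>\<longrightarrow> fel P x \<^bold>\<and> fel P y) \<^bold>\<and>
   (\<^bold>\<forall>x y. fle P x y \<^bold>\<and> fle P y x \<^bold>\<longrightarrow> x \<^bold>= y) \<^bold>\<and>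
   (\<^bold>\<forall>x y z. fle P x y \<^bold>\<and> fle P y z \<^bold>\<longrightarrow> fle P x z))"
definition "fzero B x = (fel B x \<^bold>\<and> (\<^bold>\<forall>y. fel B y \<^bold>\<longrightarrow> fle B x y))"
definition "fone B x = (fel B x \<^bold>\<and> (\<^bold>\<forall>y. fel B y \<^bold>\<longrightarrow> fle B y x))"
definition "flub B S s = (fel B s \<^bold>\<and> (\<^bold>\<forall>x. x \<^bold>\<in> S \<^bold>\<longrightarrow> fle B x s) \<^bold>\<and>
   (\<^bold>\<forall>u. fel B u \<^bold>\<and> (\<^bold>\<forall>x. x \<^bold>\<in> S \<^bold>\<longrightarrow> fle B x u) \<^bold>\<longrightarrow> fle B s u))"
definition "fjoin B x y s =
  (fle B x s \<^bold>\<and> fle B y s \<^bold>\<and> (\<^bold>\<forall>u. fle B x u \<^bold>\<and> fle B y u \<^bold>\<longrightarrow> fle B s u))"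
definition "fmeet B x y m =
  (fle B m x \<^bold>\<and> fle B m y \<^bold>\<and> (\<^bold>\<forall>u. fle B u x \<^bold>\<and> fle B u y \<^bold>\<longrightarrow> fle B u m))"
definition "fcompl B x y =
  ((\<^bold>\<exists>z. fzero B z \<^bold>\<and> fmeet B x y z) \<^bold>\<and> (\<^bold>\<exists>t. fone B t \<^bold>\<and> fjoin B x y t))"
definition "fcba B = (fposet B \<^bold>\<and>
   (\<^bold>\<forall>S. fsub S B \<^bold>\<longrightarrow> (\<^bold>\<exists>s. flub B S s)) \<^bold>\<and>
   (\<^bold>\<forall>x y z j m a b k. fjoin B y z j \<^bold>\<and> fmeet B x j m \<^bold>\<and>
      fmeet B x y a \<^bold>\<and> fmeet B x z b \<^bold>\<and> fjoin B a b k \<^bold>\<longrightarrow> m \<^bold>= k) \<^bold>\<and>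
   (\<^bold>\<forall>x. fel B x \<^bold>\<longrightarrow> (\<^bold>\<exists>y. fcompl B x y)) \<^bold>\<and>
   \<^bold>\<not> (\<^bold>\<exists>x. fzero B x \<^bold>\<and> fone B x))"
definition "fnonzero B p = (fel B p \<^bold>\<and> \<^bold>\<not> fzero B p)"

context membership
begin

lemma sat_upair: "w < n \<Longrightarrow> x < n \<Longrightarrow> y < n \<Longrightarrow>
  sat mem UNIV e (fupair w x y n) \<longleftrightarrow> is_upair (e w) (e x) (e y)"
  by (simp add: fupair_def is_upair_def)

lemma sat_pair: "z < n \<Longrightarrow> x < n \<Longrightarrow> y < n \<Longrightarrow>
  sat mem UNIV e (fpair z x y n) \<longleftrightarrow> is_pair (e z) (e x) (e y)"
  by (simp add: fpair_def is_pair_def sat_upair)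

lemma sat_le: "B < n \<Longrightarrow> x < n \<Longrightarrow> y < n \<Longrightarrow>
  sat mem UNIV e (fle B x y n) \<longleftrightarrow> le (e B) (e x) (e y)"
  by (simp add: fle_def le_def sat_pair)

lemma sat_el: "B < n \<Longrightarrow> x < n \<Longrightarrow> sat mem UNIV e (fel B x n) \<longleftrightarrow> el (e B) (e x)"
  by (simp add: fel_def el_def sat_le)

lemma sat_sub: "F < n \<Longrightarrow> B < n \<Longrightarrow> sat mem UNIV e (fsub F B n) \<longleftrightarrow> sub (e F) (e B)"
  by (simp add: fsub_def sub_def sat_el)

lemma sat_poset: "P < n \<Longrightarrow> sat mem UNIV e (fposet P n) \<longleftrightarrow> poset (e P)"
  by (simp add: fposet_def poset_def sat_el sat_le sat_pair)

lemma sat_zero: "B < n \<Longrightarrow> x < n \<Longrightarrow> sat mem UNIV e (fzero B x n) \<longleftrightarrow> is_zero (e B) (e x)"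
  by (simp add: fzero_def is_zero_def sat_el sat_le)

lemma sat_one: "B < n \<Longrightarrow> x < n \<Longrightarrow> sat mem UNIV e (fone B x n) \<longleftrightarrow> is_one (e B) (e x)"
  by (simp add: fone_def is_one_def sat_el sat_le)

lemma sat_lub: "B < n \<Longrightarrow> S < n \<Longrightarrow> s < n \<Longrightarrow>
  sat mem UNIV e (flub B S s n) \<longleftrightarrow> is_lub (e B) (e S) (e s)"
  by (simp add: flub_def is_lub_def sat_el sat_le)

lemma sat_join: "B < n \<Longrightarrow> x < n \<Longrightarrow> y < n \<Longrightarrow> s < n \<Longrightarrow>
  sat mem UNIV e (fjoin B x y s n) \<longleftrightarrow> is_join (e B) (e x) (e y) (e s)"
  by (simp add: fjoin_def is_join_def sat_le)

lemma sat_meet: "B < n \<Longrightarrow> x < n \<Longrightarrow> y < n \<Longrightarrow> m < n \<Longrightarrow>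
  sat mem UNIV e (fmeet B x y m n) \<longleftrightarrow> is_meet (e B) (e x) (e y) (e m)"
  by (simp add: fmeet_def is_meet_def sat_le)

lemma sat_compl: "B < n \<Longrightarrow> x < n \<Longrightarrow> y < n \<Longrightarrow>
  sat mem UNIV e (fcompl B x y n) \<longleftrightarrow> is_compl (e B) (e x) (e y)"
  by (simp add: fcompl_def is_compl_def sat_zero sat_one sat_join sat_meet)

lemma sat_cba: "B < n \<Longrightarrow> sat mem UNIV e (fcba B n) \<longleftrightarrow> cba (e B)"
  by (simp add: fcba_def cba_def sat_poset sat_sub sat_lub sat_join sat_meet sat_el sat_compl
      sat_zero sat_one)

lemma sat_nonzero: "B < n \<Longrightarrow> p < n \<Longrightarrow>
  sat mem UNIV e (fnonzero B p n) \<longleftrightarrow> nonzero (e B) (e p)"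
  by (simp add: fnonzero_def nonzero_def sat_el sat_zero)

lemmas sat_ba = sat_le sat_el sat_sub sat_cba sat_nonzero

section \<open>Forcing with a complete Boolean algebra\<close>

text \<open>
  Conditions are the nonzero elements. A name is a set of pairs \<open>(s, p)\<close> of a name \<open>s\<close> and an
  element \<open>p\<close> of the algebra. Membership in a closed set replaces the recursion: by the axiom of
  foundation both definitions agree.
\<close>

definition names_closed :: "'v \<Rightarrow> 'v \<Rightarrow> bool" where
  "names_closed B T \<longleftrightarrow>
     (\<forall>x z. x \<epsilon> T \<and> z \<epsilon> x \<longrightarrow> (\<exists>s p. is_pair z s p \<and> s \<epsilon> T \<and> el B p))"

definition name :: "'v \<Rightarrow> 'v \<Rightarrow> bool" where
  "name B x \<longleftrightarrow> (\<exists>T. names_closed B T \<and> x \<epsilon> T)"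

definition in_dom :: "'v \<Rightarrow> 'v \<Rightarrow> bool" where
  "in_dom s x \<longleftrightarrow> (\<exists>p. opair s p \<epsilon> x)"

text \<open>
  The relations \<open>p \<tturnstile> x = y\<close> and \<open>p \<tturnstile> x \<in> y\<close> are defined by simultaneous recursion on names:
  \<^item> \<open>p \<tturnstile> x = y\<close> iff \<open>q \<tturnstile> s \<in> x \<longleftrightarrow> q \<tturnstile> s \<in> y\<close> for all \<open>s \<in> dom x \<union> dom y\<close> and \<open>q \<le> p\<close>;
  \<^item> \<open>p \<tturnstile> x \<in> y\<close> iff the \<open>r\<close> with \<open>r \<le> b\<close>, \<open>r \<tturnstile> x = s\<close> for some \<open>(s, b) \<in> y\<close> are dense below \<open>p\<close>.

  As usual for a recursion inside a model of set theory, it is carried out by a set: \<open>Req\<close> and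
  \<open>Rmem\<close> consist of the triples \<open>(p, (x, y))\<close> in the two relations, for names in the closed set \<open>T\<close>.
\<close>

definition atomic_forcing :: "'v \<Rightarrow> 'v \<Rightarrow> 'v \<Rightarrow> 'v \<Rightarrow> bool" where
  "atomic_forcing B T Req Rmem \<longleftrightarrow> names_closed B T \<and>
     (\<forall>p x y. nonzero B p \<and> x \<epsilon> T \<and> y \<epsilon> T \<longrightarrow>
        (opair p (opair x y) \<epsilon> Req \<longleftrightarrow>
           (\<forall>s q. (in_dom s x \<or> in_dom s y) \<and> nonzero B q \<and> le B q p \<longrightarrow>
              (opair q (opair s x) \<epsilon> Rmem \<longleftrightarrow> opair q (opair s y) \<epsilon> Rmem))) \<and>
        (opair p (opair x y) \<epsilon> Rmem \<longleftrightarrow>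
           (\<forall>q. nonzero B q \<and> le B q p \<longrightarrow>
              (\<exists>r s b. nonzero B r \<and> le B r q \<and> opair s b \<epsilon> y \<and> le B r b \<and>
                 opair r (opair x s) \<epsilon> Req))))"

definition forces_eq :: "'v \<Rightarrow> 'v \<Rightarrow> 'v \<Rightarrow> 'v \<Rightarrow> bool" where
  "forces_eq B p x y \<longleftrightarrow> (\<exists>T Req Rmem. atomic_forcing B T Req Rmem \<and>
     x \<epsilon> T \<and> y \<epsilon> T \<and> opair p (opair x y) \<epsilon> Req)"

definition forces_mem :: "'v \<Rightarrow> 'v \<Rightarrow> 'v \<Rightarrow> 'v \<Rightarrow> bool" where
  "forces_mem B p x y \<longleftrightarrow> (\<exists>T Req Rmem. atomic_forcing B T Req Rmem \<and>
     x \<epsilon> T \<and> y \<epsilon> T \<and> opair p (opair x y) \<epsilon> Rmem)"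

text \<open>\<open>forces B \<phi> p e\<close>: the condition \<open>p\<close> forces \<open>\<phi>\<close>, with names \<open>e\<close> for the free variables.\<close>

primrec forces :: "'v \<Rightarrow> fm \<Rightarrow> 'v \<Rightarrow> (nat \<Rightarrow> 'v) \<Rightarrow> bool" where
  "forces B (Mem i j) p e \<longleftrightarrow> forces_mem B p (e i) (e j)"
| "forces B (Eq i j) p e \<longleftrightarrow> forces_eq B p (e i) (e j)"
| "forces B (Neg \<phi>) p e \<longleftrightarrow> \<not> (\<exists>q. nonzero B q \<and> le B q p \<and> forces B \<phi> q e)"
| "forces B (And \<phi> \<psi>) p e \<longleftrightarrow> forces B \<phi> p e \<and> forces B \<psi> p e"
| "forces B (All i \<phi>) p e \<longleftrightarrow> (\<forall>x. name B x \<longrightarrow> forces B \<phi> p (e(i := x)))"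

text \<open>\<open>env1 x\<close>, \<open>env2 x y\<close>, \<open>env3 x y z\<close> assign their arguments to the variables 0, 1, 2.\<close>

definition env1 :: "'v \<Rightarrow> nat \<Rightarrow> 'v" where "env1 x = (\<lambda>_. x)"
definition env2 :: "'v \<Rightarrow> 'v \<Rightarrow> nat \<Rightarrow> 'v" where "env2 x y = (\<lambda>_. y)(0 := x)"
definition env3 :: "'v \<Rightarrow> 'v \<Rightarrow> 'v \<Rightarrow> nat \<Rightarrow> 'v" where "env3 x y z = (\<lambda>_. z)(0 := x, 1 := y)"

definition is_bool_value :: "'v \<Rightarrow> fm \<Rightarrow> (nat \<Rightarrow> 'v) \<Rightarrow> 'v \<Rightarrow> bool" where
  "is_bool_value B \<phi> e b \<longleftrightarrow> is_lub B (setof (\<lambda>p. nonzero B p \<and> forces B \<phi> p e)) b"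

section \<open>Two-step iteration\<close>

text \<open>
  The pairs \<open>(p\<^sub>0, p\<^sub>1)\<close> form a proper class, since every element of the algebra named by
  \<open>B1\<close> has a proper class of names. As usual \<open>p\<^sub>1\<close> is taken from a set \<open>N\<close> of names containing
  representatives of all of them.
\<close>

definition full_names :: "'v \<Rightarrow> 'v \<Rightarrow> 'v \<Rightarrow> bool" where
  "full_names B0 B1 N \<longleftrightarrow> (\<forall>s. s \<epsilon> N \<longrightarrow> name B0 s) \<and>
     (\<forall>p t. nonzero B0 p \<and> name B0 t \<and> forces B0 (fel 1 0 2) p (env2 t B1) \<longrightarrow>
        (\<exists>s. s \<epsilon> N \<and> forces B0 (Eq 0 1) p (env2 s t)))"

definition it_cond :: "'v \<Rightarrow> 'v \<Rightarrow> 'v \<Rightarrow> 'v \<Rightarrow> bool" where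
  "it_cond B0 B1 N x \<longleftrightarrow> (\<exists>p0 p1. is_pair x p0 p1 \<and> nonzero B0 p0 \<and> p1 \<epsilon> N \<and>
     forces B0 (fnonzero 1 0 2) p0 (env2 p1 B1))"

definition it_le :: "'v \<Rightarrow> 'v \<Rightarrow> 'v \<Rightarrow> 'v \<Rightarrow> 'v \<Rightarrow> bool" where
  "it_le B0 B1 N x y \<longleftrightarrow> it_cond B0 B1 N x \<and> it_cond B0 B1 N y \<and>
     (\<exists>q0 q1 p0 p1. is_pair x q0 q1 \<and> is_pair y p0 p1 \<and> le B0 q0 p0 \<and>
        forces B0 (fle 2 0 1 3) q0 (env3 q1 p1 B1))"

definition it_sle :: "'v \<Rightarrow> 'v \<Rightarrow> 'v \<Rightarrow> 'v \<Rightarrow> 'v \<Rightarrow> bool" where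
  "it_sle B0 B1 N x y \<longleftrightarrow> it_cond B0 B1 N x \<and> it_cond B0 B1 N y \<and>
     (\<forall>z. it_le B0 B1 N z x \<longrightarrow> (\<exists>w. it_le B0 B1 N w z \<and> it_le B0 B1 N w y))"

definition it_class :: "'v \<Rightarrow> 'v \<Rightarrow> 'v \<Rightarrow> 'v \<Rightarrow> 'v" where
  "it_class B0 B1 N x = setof (\<lambda>y. it_sle B0 B1 N x y \<and> it_sle B0 B1 N y x)"

text \<open>The separative quotient together with the empty set as zero.\<close>

definition it_carrier :: "'v \<Rightarrow> 'v \<Rightarrow> 'v \<Rightarrow> 'v \<Rightarrow> bool" where
  "it_carrier B0 B1 N u \<longleftrightarrow>
     u = setof (\<lambda>_. False) \<or> (\<exists>x. it_cond B0 B1 N x \<and> u = it_class B0 B1 N x)"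

definition it_algebra :: "'v \<Rightarrow> 'v \<Rightarrow> 'v \<Rightarrow> 'v" where
  "it_algebra B0 B1 N = setof (\<lambda>z. \<exists>u v. is_pair z u v \<and>
     it_carrier B0 B1 N u \<and> it_carrier B0 B1 N v \<and>
     (u = setof (\<lambda>_. False) \<or>
      (\<exists>x y. u = it_class B0 B1 N x \<and> v = it_class B0 B1 N y \<and> it_sle B0 B1 N x y)))"

definition it_set :: "'v \<Rightarrow> 'v \<Rightarrow> 'v \<Rightarrow> 'v \<Rightarrow> 'v \<Rightarrow> 'v" where
  "it_set B0 B1 N F0 F1 = setof (\<lambda>u. \<exists>x p0 p1 b m. it_cond B0 B1 N x \<and> is_pair x p0 p1 \<and>
     u = it_class B0 B1 N x \<and>
     is_bool_value B0 (Mem 0 1) (env2 p1 F1) b \<and> is_meet B0 p0 b m \<and> m \<epsilon> F0)"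

section \<open>Regularity properties\<close>

text \<open>In a formula \<open>\<Phi>\<close> for a property \<open>\<Phi>(F, B)\<close> the variable 0 stands for \<open>F\<close> and 1 for \<open>B\<close>.\<close>

definition holds :: "fm \<Rightarrow> 'v \<Rightarrow> 'v \<Rightarrow> bool" where
  "holds \<Phi> F B \<longleftrightarrow> sat mem UNIV (env2 F B) \<Phi>"

definition regular1 :: "fm \<Rightarrow> bool" where
  "regular1 \<Phi> \<longleftrightarrow> (\<forall>B t. cba B \<and> is_one B t \<longrightarrow> holds \<Phi> (setof (\<lambda>x. x = t)) B)"

definition regular2 :: "fm \<Rightarrow> bool" where
  "regular2 \<Phi> \<longleftrightarrow> (\<forall>B F. cba B \<and> sub F B \<and> holds \<Phi> F B \<longrightarrow> holds \<Phi> (up_closure B F) B)"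

text \<open>
  The restriction to \<open>p \<noteq> 0\<close> is implicit in \<open>B\<restriction>p\<close> being a Boolean algebra with \<open>0 \<noteq> 1\<close>. For \<open>p = 0\<close>
  the clauses would give \<open>\<Phi>({0}, B\<restriction>0)\<close>, hence \<open>\<Phi>({0}, B)\<close> and \<open>\<Phi>(B, B)\<close> for every \<open>B\<close>.
\<close>

definition regular3 :: "fm \<Rightarrow> bool" where
  "regular3 \<Phi> \<longleftrightarrow> (\<forall>B p F. cba B \<and> nonzero B p \<longrightarrow>
     (sub F B \<and> holds \<Phi> F B \<longrightarrow>
        holds \<Phi> (setof (\<lambda>x. x \<epsilon> F \<and> el (restrict B p) x)) (restrict B p)) \<and>
     (sub F (restrict B p) \<and> holds \<Phi> F (restrict B p) \<longrightarrow> holds \<Phi> F B))"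

definition regular4 :: "fm \<Rightarrow> bool" where
  "regular4 \<Phi> \<longleftrightarrow> (\<forall>B0 B1 F. complete_subalgebra B0 B1 \<longrightarrow>
     (sub F B1 \<and> holds \<Phi> F B1 \<longrightarrow> holds \<Phi> (setof (\<lambda>x. x \<epsilon> F \<and> el B0 x)) B0) \<and>
     (sub F B0 \<and> holds \<Phi> F B0 \<longrightarrow> holds \<Phi> F B1))"

definition regular5 :: "fm \<Rightarrow> bool" where
  "regular5 \<Phi> \<longleftrightarrow> (\<forall>B0 t B1 F0 F1 N.
     cba B0 \<and> is_one B0 t \<and>
     name B0 B1 \<and> forces B0 (fcba 0 1) t (env1 B1) \<and>
     sub F0 B0 \<and>
     name B0 F1 \<and> forces B0 (fsub 0 1 2) t (env2 F1 B1) \<and>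
     holds \<Phi> F0 B0 \<and> forces B0 \<Phi> t (env2 F1 B1) \<and>
     full_names B0 B1 N \<longrightarrow>
     holds \<Phi> (it_set B0 B1 N F0 F1) (it_algebra B0 B1 N))"

end

text \<open>
  A statement is provable in ZFC iff it is true in all models of ZFC, equivalently (by the
  downward Loewenheim-Skolem theorem) in all models whose domain is the set of natural numbers.
  The five clauses are first-order statements about the model.
\<close>

definition regularity_property :: "fm \<Rightarrow> bool" where
  "regularity_property \<Phi> \<longleftrightarrow> fv \<Phi> \<subseteq> {0, 1} \<and>
     (\<forall>E :: nat \<Rightarrow> nat \<Rightarrow> bool. membership.zfc_model E \<longrightarrow>
        membership.regular1 E \<Phi> \<and> membership.regular2 E \<Phi> \<and> membership.regular3 E \<Phi> \<and>
        membership.regular4 E \<Phi> \<and> membership.regular5 E \<Phi>)"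

section \<open>Chain conditions\<close>

text \<open>The notions below are used in a \<open>zfc_universe\<close> only.\<close>

context membership
begin

definition compatible :: "'v \<Rightarrow> 'v \<Rightarrow> 'v \<Rightarrow> bool" where
  "compatible P x y \<longleftrightarrow> (\<exists>z. le P z x \<and> le P z y)"

definition ccc :: "'v \<Rightarrow> bool" where
  "ccc P \<longleftrightarrow> (\<forall>A. sub A P \<and> (\<forall>x y. x \<epsilon> A \<and> y \<epsilon> A \<and> x \<noteq> y \<longrightarrow> \<not> compatible P x y) \<longrightarrow>
     countable (ext A))"

text \<open>Antichains of a Boolean algebra consist of nonzero elements with pairwise meets zero.\<close>

definition ba_antichain :: "'v \<Rightarrow> 'v \<Rightarrow> bool" where
  "ba_antichain B A \<longleftrightarrow> (\<forall>x. x \<epsilon> A \<longrightarrow> nonzero B x) \<and>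
     (\<forall>x y z. x \<epsilon> A \<and> y \<epsilon> A \<and> x \<noteq> y \<and> is_meet B x y z \<longrightarrow> is_zero B z)"

text \<open>
  The completion of \<open>P\<close> is the algebra of regular open subsets, ordered by inclusion, for the
  topology of downward closed sets. \<open>ro_embed P q\<close> is the interior of the closure of the cone
  below \<open>q\<close>.
\<close>

definition regular_open :: "'v \<Rightarrow> 'v \<Rightarrow> bool" where
  "regular_open P U \<longleftrightarrow>
     (\<forall>p. p \<epsilon> U \<longleftrightarrow> el P p \<and> (\<forall>q. le P q p \<longrightarrow> (\<exists>r. le P r q \<and> r \<epsilon> U)))"

definition RO :: "'v \<Rightarrow> 'v" where
  "RO P = setof (\<lambda>z. \<exists>U W. is_pair z U W \<and> regular_open P U \<and> regular_open P W \<and> ext U \<subseteq> ext W)"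

definition ro_embed :: "'v \<Rightarrow> 'v \<Rightarrow> 'v" where
  "ro_embed P q = setof (\<lambda>p. el P p \<and> (\<forall>r. le P r p \<longrightarrow> compatible P r q))"

text \<open>
  Infinite cardinals are given as \<open>|ext a|\<close> for sets \<open>a\<close>. \<open>H a\<close> is the class of all sets whose
  transitive closure has cardinality less than \<open>|ext a|\<close>.
\<close>

definition regular_cardinal :: "'v \<Rightarrow> bool" where
  "regular_cardinal a \<longleftrightarrow> infinite (ext a) \<and> regularCard |ext a|"

definition H :: "'v \<Rightarrow> 'v set" where
  "H a = {x. |{y. mem\<^sup>+\<^sup>+ y x}| <o |ext a|}"

text \<open>``\<open>\<theta>\<close> large'' means: for all regular \<open>\<theta>\<close> above some bound depending on \<open>P\<close>.\<close>

definition Phi_cc :: "fm \<Rightarrow> 'v \<Rightarrow> bool" where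
  "Phi_cc \<Phi> P \<longleftrightarrow>
     (\<exists>bound. \<forall>\<theta>. regular_cardinal \<theta> \<and> |ext bound| <o |ext \<theta>| \<longrightarrow>
        (\<forall>q M. el P q \<and> countable (ext M) \<and> elementary mem (ext M) (H \<theta>) \<and> P \<epsilon> M \<longrightarrow>
           (\<exists>F. F \<epsilon> M \<and> sub F (RO P) \<and> holds \<Phi> F (RO P) \<and>
              (\<forall>p. el (RO P) p \<and> p \<epsilon> M \<and> le (RO P) (ro_embed P q) p \<longrightarrow> p \<epsilon> F))))"

end

end

theory Submission
  imports Defs
begin

text \<open>
  Suppose that \<open>P\<close> has an uncountable antichain, and let \<open>(S \<alpha> n)\<close> be an Ulam matrix on a part \<open>J\<close>
  of it of size \<open>\<aleph>\<^sub>1\<close>: the sets in each column are disjoint, and each row covers all but countably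
  many elements of \<open>J\<close>. Let \<open>M\<close> be a countable elementary submodel containing the set \<open>R\<close> of all
  rows, a row being the set of the suprema in \<open>RO P\<close> of its nonempty entries. Some \<open>q \<in> J\<close> is covered
  by every row in \<open>M\<close>, so that every row in \<open>M\<close> has an element above \<open>q\<close>. Hence the set \<open>F \<in> M\<close> given
  by the chain condition for \<open>q\<close> meets every row in \<open>M\<close>, and by elementarity every row in \<open>R\<close>.
  Uncountably many rows are met in the same column, which yields an uncountable antichain in \<open>F\<close>.
\<close>

section \<open>Countable elementary submodels\<close>

instance fm :: countable
  by countable_datatype

lemma finite_fv: "finite (fv \<phi>)"
  by (induction \<phi>) auto

lemma sat_cong_fv: "(\<And>i. i \<in> fv \<phi> \<Longrightarrow> e i = e' i) \<Longrightarrow> sat mem D e \<phi> \<longleftrightarrow> sat mem D e' \<phi>"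
proof (induction \<phi> arbitrary: e e')
  case (All i \<phi>)
  have "sat mem D (e(i := a)) \<phi> \<longleftrightarrow> sat mem D (e'(i := a)) \<phi>" for a
    by (rule All.IH) (use All.prems in auto)
  then show ?case by simp
next
  case (And \<phi> \<psi>)
  from And.IH(1)[of e e'] And.IH(2)[of e e'] And.prems show ?case by simp
next
  case (Neg \<phi>)
  from Neg.IH[of e e'] Neg.prems show ?case by simp
qed simp_all

text \<open>Closing off stage by stage finishes after \<omega> steps: an argument list is finite, so
  all its entries are present at some stage \<open>K k\<close>, and the value of \<open>g\<close>
  enters at the next one. Every stage is countable because there are countably many indices and
  countably many lists over a countable set.\<close>

lemma countable_closure:
  fixes g :: "'i::countable \<Rightarrow> 'v list \<Rightarrow> 'v"
  assumes "countable C" "C \<subseteq> N" and g: "\<And>i xs. set xs \<subseteq> N \<Longrightarrow> g i xs \<in> N"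
  obtains M where "countable M" "C \<subseteq> M" "M \<subseteq> N" "\<And>i xs. set xs \<subseteq> M \<Longrightarrow> g i xs \<in> M"
proof -
  define step where "step X = X \<union> (\<lambda>(i, xs). g i xs) ` (UNIV \<times> lists X)" for X
  define K where "K k = (step ^^ k) C" for k
  have K: "K 0 = C" "K (Suc k) = step (K k)" for k by (auto simp: K_def)
  have cnt: "countable (K k)" for k
  proof (induction k)
    case (Suc k)
    then show ?case unfolding K step_def
      by (intro countable_Un countable_image countable_SIGMA countable_lists) auto
  qed (simp add: K assms)
  have N: "K k \<subseteq> N" for k
  proof (induction k)
    case (Suc k)
    then have "g i xs \<in> N" if "xs \<in> lists (K k)" for i xs
      using g[of xs i] that by (auto simp: in_lists_conv_set)
    then have "(\<lambda>(i, xs). g i xs) ` (UNIV \<times> lists (K k)) \<subseteq> N" by (auto simp del: in_lists_conv_set)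
    with Suc show ?case unfolding K step_def by (rule Un_least)
  qed (simp add: K assms)
  have mono: "K k \<subseteq> K l" if "k \<le> l" for k l
    using lift_Suc_mono_le[OF _ that, of K] by (simp add: K step_def)
  have fin: "\<exists>k. set xs \<subseteq> K k" if "set xs \<subseteq> (\<Union>k. K k)" for xs
    using that
  proof (induction xs)
    case (Cons x xs)
    then obtain k l where "set xs \<subseteq> K k" "x \<in> K l" by auto
    then have "set (x # xs) \<subseteq> K (max k l)"
      using mono[of k "max k l"] mono[of l "max k l"] by auto
    then show ?case by blast
  qed auto
  show ?thesis
  proof (rule that)
    show "countable (\<Union>k. K k)" using cnt by simp
    show "C \<subseteq> (\<Union>k. K k)" using K(1) by blast
    show "(\<Union>k. K k) \<subseteq> N" using N by blast
    show "g i xs \<in> (\<Union>k. K k)" if xs: "set xs \<subseteq> (\<Union>k. K k)" for i xs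
    proof -
      obtain k where "set xs \<subseteq> K k" using fin[OF xs] by blast
      then have "g i xs \<in> K (Suc k)" unfolding K step_def
        by (intro UnI2 image_eqI[of _ _ "(i, xs)"]) (auto simp: in_lists_conv_set)
      then show ?thesis by blast
    qed
  qed
qed

text \<open>By induction on the formula; only the quantifier needs the criterion. Applied to the
  negated body, it moves a counterexample from \<open>N\<close> into \<open>M\<close>.\<close>

lemma elementary_if_Tarski_Vaught:
  assumes "M \<noteq> {}" "M \<subseteq> N"
    and tv: "\<And>\<phi> i e a. range e \<subseteq> M \<Longrightarrow> a \<in> N \<Longrightarrow> sat mem N (e(i := a)) \<phi> \<Longrightarrow>
      \<exists>b\<in>M. sat mem N (e(i := b)) \<phi>"
  shows "elementary mem M N"
proof -
  have "sat mem M e \<phi> \<longleftrightarrow> sat mem N e \<phi>" if "range e \<subseteq> M" for e \<phi>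
    using that
  proof (induction \<phi> arbitrary: e)
    case (All i \<phi>)
    have IH: "sat mem M (e(i := a)) \<phi> \<longleftrightarrow> sat mem N (e(i := a)) \<phi>" if "a \<in> M" for a
      by (rule All.IH) (use All.prems that in auto)
    have "\<exists>b\<in>M. \<not> sat mem N (e(i := b)) \<phi>" if "a \<in> N" "\<not> sat mem N (e(i := a)) \<phi>" for a
      using tv[of e a i "Neg \<phi>"] All.prems that by simp
    then show ?case using IH \<open>M \<subseteq> N\<close> by (simp, blast)
  qed auto
  then show ?thesis using assms unfolding elementary_def by blast
qed

text \<open>Downward Loewenheim-Skolem: close \<open>C\<close> under Skolem functions for
  \<open>N\<close>. Closing under the maps \<open>c n\<close> at the same time makes
  \<open>M\<close> closed under them although they may be undefinable in \<open>N\<close>.\<close>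

lemma countable_elementary_submodel:
  fixes mem :: "'v \<Rightarrow> 'v \<Rightarrow> bool" and c :: "nat \<Rightarrow> 'v \<Rightarrow> 'v"
  assumes "countable C" "C \<subseteq> N" "C \<noteq> {}" and c: "\<And>n x. x \<in> N \<Longrightarrow> c n x \<in> N"
  obtains M where "countable M" "C \<subseteq> M" "elementary mem M N" "\<And>n x. x \<in> M \<Longrightarrow> c n x \<in> M"
proof -
  obtain a0 where a0: "a0 \<in> C" "a0 \<in> N" using assms by blast
  \<comment> \<open>Skolem functions must take finite lists to fit \<open>countable_closure\<close>,
    so a list is padded by \<open>a0\<close> to an environment. In \<open>g\<close>, the index
    \<open>Inl n\<close> stands for \<open>c n\<close> at the head of the list,
    \<open>Inr (\<phi>, i)\<close> for a witness of \<phi> in variable \<open>i\<close>;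
    \<open>a0\<close> also serves where there is no witness.\<close>
  define env where "env xs i = (if i < length xs then xs ! i else a0)" for xs i
  define g where "g s xs = (case s of
      Inl n \<Rightarrow> if xs = [] then a0 else c n (hd xs)
    | Inr (\<phi>, i) \<Rightarrow> if \<exists>a\<in>N. sat mem N ((env xs)(i := a)) \<phi>
        then SOME a. a \<in> N \<and> sat mem N ((env xs)(i := a)) \<phi> else a0)" for s xs
  have g: "g s xs \<in> N" if "set xs \<subseteq> N" for s xs
  proof (cases s)
    case (Inl n)
    with that show ?thesis by (cases xs) (auto simp: g_def a0 c)
  next
    case (Inr p)
    obtain \<phi> i where p: "p = (\<phi>, i)" by (cases p)
    show ?thesis
    proof (cases "\<exists>a\<in>N. sat mem N ((env xs)(i := a)) \<phi>")
      case True
      then have "\<exists>a. a \<in> N \<and> sat mem N ((env xs)(i := a)) \<phi>" by blast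
      from someI_ex[OF this] show ?thesis using True by (simp add: g_def Inr p)
    qed (simp add: g_def Inr p a0)
  qed
  obtain M where M: "countable M" "C \<subseteq> M" "M \<subseteq> N"
    and closed: "\<And>s xs. set xs \<subseteq> M \<Longrightarrow> g s xs \<in> M"
    using countable_closure[of C N g] assms(1,2) g by metis
  have "elementary mem M N"
  proof (rule elementary_if_Tarski_Vaught)
    show "M \<noteq> {}" "M \<subseteq> N" using M \<open>C \<noteq> {}\<close> by auto
    fix \<phi> i e a assume e: "range e \<subseteq> M" and a: "a \<in> N" "sat mem N (e(i := a)) \<phi>"
    \<comment> \<open>Only the values of \<open>e\<close> below a bound of the free variables
      matter, so the list of the first \<open>m\<close> values represents \<open>e\<close>.\<close>
    obtain m where m: "\<And>j. j \<in> fv \<phi> \<Longrightarrow> j < m"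
      using finite_fv[of \<phi>] by (meson finite_nat_bounded lessThan_iff subsetD)
    define xs where "xs = map e [0..<m]"
    have env: "sat mem N ((env xs)(i := b)) \<phi> \<longleftrightarrow> sat mem N (e(i := b)) \<phi>" for b
      by (rule sat_cong_fv) (use m in \<open>auto simp: env_def xs_def\<close>)
    have "g (Inr (\<phi>, i)) xs \<in> M" by (rule closed) (use e in \<open>auto simp: xs_def\<close>)
    moreover have "sat mem N (e(i := g (Inr (\<phi>, i)) xs)) \<phi>"
    proof -
      have ex: "\<exists>a. a \<in> N \<and> sat mem N ((env xs)(i := a)) \<phi>" using a env by blast
      then have "g (Inr (\<phi>, i)) xs = (SOME a. a \<in> N \<and> sat mem N ((env xs)(i := a)) \<phi>)"
        by (auto simp: g_def)
      with someI_ex[OF ex] env show ?thesis by simp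
    qed
    ultimately show "\<exists>b\<in>M. sat mem N (e(i := b)) \<phi>" by blast
  qed
  moreover have "c n x \<in> M" if "x \<in> M" for n x
    using closed[of "[x]" "Inl n"] that by (simp add: g_def)
  ultimately show ?thesis using M that by blast
qed

section \<open>Ulam matrices\<close>

lemma uncountable_iff_cardSuc_natLeq: "uncountable A \<longleftrightarrow> cardSuc natLeq \<le>o |A|"
proof -
  have "countable A \<longleftrightarrow> |A| \<le>o |UNIV :: nat set|"
    using card_of_ordLeq[of A "UNIV :: nat set"] by (auto simp: countable_def)
  also have "\<dots> \<longleftrightarrow> |A| \<le>o natLeq"
    using card_of_nat ordIso_symmetric ordLeq_ordIso_trans by blast
  also have "\<dots> \<longleftrightarrow> |A| <o cardSuc natLeq"
    by (simp add: cardSuc_ordLeq_ordLess natLeq_Card_order card_of_Card_order)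
  finally show ?thesis
    using not_ordLess_iff_ordLeq[OF cardSuc_Well_order[OF natLeq_Card_order] card_of_Well_order]
    by blast
qed

lemma Ulam_matrix:
  fixes A :: "'a set"
  assumes "uncountable A"
  obtains J and S :: "'a \<Rightarrow> nat \<Rightarrow> 'a set"
  where "J \<subseteq> A" "uncountable J" "\<And>\<alpha> n. S \<alpha> n \<subseteq> J"
    "\<And>\<alpha>. \<alpha> \<in> J \<Longrightarrow> countable (J - (\<Union>n. S \<alpha> n))"
    "\<And>\<alpha> \<beta> n. \<alpha> \<in> J \<Longrightarrow> \<beta> \<in> J \<Longrightarrow> \<alpha> \<noteq> \<beta> \<Longrightarrow> S \<alpha> n \<inter> S \<beta> n = {}"
proof -
  let ?r = "cardSuc natLeq"
  define I where "I = Field ?r"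
  have co: "Card_order ?r" by (simp add: cardSuc_Card_order natLeq_Card_order)
  then have wo: "Well_order ?r" by (simp add: cardSuc_Well_order natLeq_Card_order)
  have rI: "?r =o |I|" unfolding I_def using card_of_Field_ordIso[OF co] ordIso_symmetric by blast
  have "|I| \<le>o |A|"
    using assms rI by (meson uncountable_iff_cardSuc_natLeq ordIso_ordLeq_trans ordIso_symmetric)
  then obtain h where h: "inj_on h I" "h ` I \<subseteq> A" using card_of_ordLeq[of I A] by blast
  have "uncountable I"
    using rI by (simp add: uncountable_iff_cardSuc_natLeq ordIso_iff_ordLeq)
  have below: "countable (underS ?r i)" if "i \<in> I" for i
  proof -
    have "|underS ?r i| <o ?r" using card_of_underS[OF co] that I_def by blast
    then show ?thesis
      using uncountable_iff_cardSuc_natLeq not_ordLess_ordLeq by blast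
  qed
  define f where "f i = to_nat_on (underS ?r i)" for i
  have f: "inj_on (f i) (underS ?r i)" if "i \<in> I" for i
    unfolding f_def using below[OF that] by blast
  define g where "g = the_inv_into I h"
  have g: "g (h i) = i" if "i \<in> I" for i
    using that h by (simp add: g_def the_inv_into_f_f)
  define S where "S \<alpha> n = h ` {i \<in> I. g \<alpha> \<in> underS ?r i \<and> f i (g \<alpha>) = n}" for \<alpha> n
  show ?thesis
  proof (rule that)
    show "h ` I \<subseteq> A" "uncountable (h ` I)"
      using h \<open>uncountable I\<close> countable_image_inj_on by blast+
    show "S \<alpha> n \<subseteq> h ` I" for \<alpha> n by (auto simp: S_def)
    show "countable (h ` I - (\<Union>n. S \<alpha> n))" if "\<alpha> \<in> h ` I" for \<alpha>
    proof -
      obtain i where i: "i \<in> I" "\<alpha> = h i" using \<open>\<alpha> \<in> h ` I\<close> by blast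
      \<comment> \<open>Row \<alpha> contains every point whose index is above \<open>i\<close>. By
        totality of the order, a missed index is \<open>i\<close> itself or one of its countably
        many predecessors.\<close>
      have "h ` I - (\<Union>n. S \<alpha> n) \<subseteq> h ` (insert i (underS ?r i))"
      proof
        fix x assume "x \<in> h ` I - (\<Union>n. S \<alpha> n)"
        then obtain j where j: "j \<in> I" "x = h j" "i \<notin> underS ?r j"
          by (auto simp: S_def i g)
        moreover have "i = j \<or> (i, j) \<in> ?r \<or> (j, i) \<in> ?r"
          using wo i j unfolding I_def well_order_on_def linear_order_on_def total_on_def by blast
        ultimately show "x \<in> h ` (insert i (underS ?r i))"
          unfolding underS_def by blast
      qed
      then show ?thesis
        using below[OF i(1)] by (meson countable_image countable_insert countable_subset)
    qed
    show "S \<alpha> n \<inter> S \<beta> n = {}" if "\<alpha> \<in> h ` I" "\<beta> \<in> h ` I" "\<alpha> \<noteq> \<beta>" for \<alpha> \<beta> n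
    proof (rule ccontr)
      obtain i j where ij: "i \<in> I" "\<alpha> = h i" "j \<in> I" "\<beta> = h j" "i \<noteq> j"
        using \<open>\<alpha> \<in> h ` I\<close> \<open>\<beta> \<in> h ` I\<close> \<open>\<alpha> \<noteq> \<beta>\<close> by blast
      assume "S \<alpha> n \<inter> S \<beta> n \<noteq> {}"
      then obtain k l where k: "k \<in> I" "i \<in> underS ?r k" "f k i = n"
        and l: "l \<in> I" "j \<in> underS ?r l" "f l j = n" and "h k = h l"
        unfolding S_def using ij g by auto
      then have "k = l" using h inj_onD by fastforce
      then have "i = j" using inj_onD[OF f[OF l(1)]] k l by blast
      with ij show False by blast
    qed
  qed
qed

section \<open>Classes that are sets\<close>

locale set_universe = membership +
  assumes universe: zfc_universe
begin

lemma mem_ext [simp]: "x \<in> ext a \<longleftrightarrow> x \<epsilon> a"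
  by (simp add: ext_def)

lemma ext_inject: "ext a = ext b \<longleftrightarrow> a = b"
proof
  have "\<forall>x y. (\<forall>z. z \<epsilon> x \<longleftrightarrow> z \<epsilon> y) \<longrightarrow> x = y"
    using universe unfolding zfc_universe_def finite_zfc_axioms_def by (elim conjE)
  then show "ext a = ext b \<Longrightarrow> a = b" by (simp add: ext_def set_eq_iff)
qed simp

text \<open>Since the axioms of \<open>zfc_universe\<close> range over all predicates of the logic,
  \<open>small\<close> is closed under arbitrary subsets and images, with no definability to check.
  This allows reasoning about HOL sets, with \<open>ext\<close> and \<open>mk\<close> translating
  back and forth.\<close>

definition small :: "'a set \<Rightarrow> bool" where
  "small X \<longleftrightarrow> (\<exists>s. ext s = X)"

definition mk :: "'a set \<Rightarrow> 'a" where
  "mk X = (THE s. ext s = X)"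

lemma ext_mk [simp]: "small X \<Longrightarrow> ext (mk X) = X"
  unfolding small_def mk_def by (rule theI') (metis ext_inject)

lemma small_ext [simp]: "small (ext a)"
  by (auto simp: small_def)

lemma mk_ext [simp]: "mk (ext a) = a"
  using ext_mk[OF small_ext] by (simp only: ext_inject)

lemma setof_eq_mk: "setof Q = mk {x. Q x}"
  by (simp add: setof_def mk_def ext_def set_eq_iff)

lemma small_subset: "small X \<Longrightarrow> Y \<subseteq> X \<Longrightarrow> small Y"
proof -
  assume "small X" "Y \<subseteq> X"
  then obtain a where a: "ext a = X" by (auto simp: small_def)
  have "separation_for (\<lambda>x. x \<in> Y)" using universe by (simp add: zfc_universe_def)
  then obtain b where "\<And>x. x \<epsilon> b \<longleftrightarrow> x \<epsilon> a \<and> x \<in> Y" unfolding separation_for_def by blast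
  then have "ext b = Y" using a \<open>Y \<subseteq> X\<close> by (auto simp: ext_def)
  then show ?thesis by (auto simp: small_def)
qed

lemma small_image: "small X \<Longrightarrow> small (f ` X)"
proof -
  assume "small X"
  then obtain a where a: "ext a = X" by (auto simp: small_def)
  have "replacement_for (\<lambda>x y. y = f x)" using universe by (simp add: zfc_universe_def)
  then have "\<forall>a. \<exists>b. \<forall>y. y \<epsilon> b \<longleftrightarrow> (\<exists>x. x \<epsilon> a \<and> y = f x)"
    unfolding replacement_for_def by simp
  then obtain b where "\<And>y. y \<epsilon> b \<longleftrightarrow> (\<exists>x. x \<epsilon> a \<and> y = f x)" by blast
  then have "ext b = f ` X" using a by (auto simp: ext_def)
  then show ?thesis by (auto simp: small_def)
qed

lemma small_pair: "small {x, y}"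
proof -
  obtain z where "\<And>w. w \<epsilon> z \<longleftrightarrow> w = x \<or> w = y"
    using universe unfolding zfc_universe_def finite_zfc_axioms_def by metis
  then have "ext z = {x, y}" by (auto simp: ext_def)
  then show ?thesis by (auto simp: small_def)
qed

text \<open>Replacement collects the codes \<open>mk (X i)\<close> into one set, and the axiom of
  union applies to it.\<close>

lemma small_UN:
  assumes "small I" "\<And>i. i \<in> I \<Longrightarrow> small (X i)"
  shows "small (\<Union>i\<in>I. X i)"
proof -
  obtain a where a: "ext a = (\<lambda>i. mk (X i)) ` I"
    using small_image[OF \<open>small I\<close>, of "\<lambda>i. mk (X i)"] unfolding small_def by blast
  obtain u where u: "\<And>z. z \<epsilon> u \<longleftrightarrow> (\<exists>y. y \<epsilon> a \<and> z \<epsilon> y)"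
    using universe unfolding zfc_universe_def finite_zfc_axioms_def by metis
  have "ext u = (\<Union>y\<in>ext a. ext y)" using u unfolding ext_def by blast
  also have "\<dots> = (\<Union>i\<in>I. X i)" using assms by (simp add: a)
  finally show ?thesis by (auto simp: small_def)
qed

lemma small_Un: "small X \<Longrightarrow> small Y \<Longrightarrow> small (X \<union> Y)"
  using small_UN[OF small_pair, of "mk X" "mk Y" ext] by simp

lemma small_Pow: "small X \<Longrightarrow> small {y. ext y \<subseteq> X}"
proof -
  assume "small X"
  then obtain a where a: "ext a = X" by (auto simp: small_def)
  obtain p where "\<And>y. y \<epsilon> p \<longleftrightarrow> (\<forall>z. z \<epsilon> y \<longrightarrow> z \<epsilon> a)"
    using universe unfolding zfc_universe_def finite_zfc_axioms_def by metis
  then have "ext p = {y. ext y \<subseteq> X}" using a by (auto simp: ext_def)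
  then show ?thesis by (auto simp: small_def)
qed

section \<open>Infinite sets, countable sets and transitive closures\<close>

lemma mem_irrefl: "\<not> x \<epsilon> x"
proof
  assume "x \<epsilon> x"
  have *: "y \<epsilon> mk {x} \<longleftrightarrow> y = x" for y
    using small_pair[of x x] by (simp flip: mem_ext)
  then have "\<exists>y. y \<epsilon> mk {x} \<and> \<not> (\<exists>z. z \<epsilon> mk {x} \<and> z \<epsilon> y)"
    using universe unfolding zfc_universe_def finite_zfc_axioms_def by metis
  with * \<open>x \<epsilon> x\<close> show False by auto
qed

text \<open>Iterate the successor from an element of an inductive set. Successors keep the old
  elements, so earlier terms belong to later ones, and \<open>mem_irrefl\<close> makes the terms
  distinct.\<close>

lemma ex_infinite_set: "\<exists>w. infinite (ext w)"
proof -
  have "\<exists>w. (\<exists>z. z \<epsilon> w \<and> (\<forall>y. \<not> y \<epsilon> z)) \<and>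
      (\<forall>x. x \<epsilon> w \<longrightarrow> (\<exists>s. s \<epsilon> w \<and> (\<forall>y. y \<epsilon> s \<longleftrightarrow> y \<epsilon> x \<or> y = x)))"
    using universe unfolding zfc_universe_def finite_zfc_axioms_def by (elim conjE) assumption
  then obtain w z where z: "z \<epsilon> w"
    and "\<forall>x. x \<epsilon> w \<longrightarrow> (\<exists>s. s \<epsilon> w \<and> (\<forall>y. y \<epsilon> s \<longleftrightarrow> y \<epsilon> x \<or> y = x))"
    by (elim exE conjE)
  then obtain s where s: "\<And>x. x \<epsilon> w \<Longrightarrow> s x \<epsilon> w"
      "\<And>x y. x \<epsilon> w \<Longrightarrow> y \<epsilon> s x \<longleftrightarrow> y \<epsilon> x \<or> y = x"
    by metis
  define t where "t n = (s ^^ n) z" for n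
  have t: "t n \<epsilon> w" for n by (induction n) (auto simp: t_def z s)
  have lt: "t m \<epsilon> t n" if "m < n" for m n
    using that
  proof (induction n)
    case (Suc n)
    have "t (Suc n) = s (t n)" by (simp add: t_def)
    then show ?case using Suc s(2)[OF t] less_Suc_eq by auto
  qed simp
  have "inj t" by (rule linorder_injI) (metis lt mem_irrefl)
  moreover have "range t \<subseteq> ext w" using t by auto
  ultimately have "infinite (ext w)" by (metis infinite_super range_inj_infinite)
  then show ?thesis by (rule exI)
qed

text \<open>Separation yields a small copy of the natural numbers inside an infinite set;
  replacement along an enumeration of \<open>X\<close> does the rest. The last passage to a subset
  also covers empty \<open>X\<close>, for which the enumeration takes arbitrary values.\<close>

lemma small_countable: "countable X \<Longrightarrow> small X"
proof -
  assume X: "countable X"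
  obtain w where w: "infinite (ext w)" using ex_infinite_set by blast
  then obtain i :: "nat \<Rightarrow> 'a" where i: "inj i" "range i \<subseteq> ext w"
    using infinite_countable_subset[OF w] by metis
  have "small (range i)" using small_subset[OF small_ext i(2)] .
  then have "small ((from_nat_into X \<circ> inv i) ` range i)" by (rule small_image)
  also have "(from_nat_into X \<circ> inv i) ` range i = range (from_nat_into X)"
    using i by (simp add: image_image)
  finally show ?thesis using subset_range_from_nat_into[OF X] by (rule small_subset)
qed

lemma small_UN_nat:
  fixes X :: "nat \<Rightarrow> 'a set"
  assumes "\<And>n. small (X n)"
  shows "small (\<Union>n. X n)"
proof -
  have "small (\<Union>y\<in>range (\<lambda>n. mk (X n)). ext y)"
    by (rule small_UN[OF small_countable]) simp_all
  then show ?thesis using assms by simp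
qed

text \<open>The set \<open>f n\<close> holds what is reached from \<open>x\<close> by
  \<open>n + 1\<close> downward membership steps, so countably many unions exhaust the
  closure.\<close>

lemma small_transitive_closure: "small {y. mem\<^sup>+\<^sup>+ y x}"
proof -
  define f where "f n = ((\<lambda>Y. \<Union>y\<in>Y. ext y) ^^ n) (ext x)" for n :: nat
  have "small (f n)" for n
  proof (induction n)
    case (Suc n)
    then have "small (\<Union>y\<in>f n. ext y)" by (rule small_UN) simp
    then show ?case by (simp add: f_def)
  qed (simp add: f_def)
  then have "small (\<Union>n. f n)" by (rule small_UN_nat)
  moreover have "{y. mem\<^sup>+\<^sup>+ y x} \<subseteq> (\<Union>n. f n)"
  proof clarify
    fix y assume "mem\<^sup>+\<^sup>+ y x"
    then show "y \<in> (\<Union>n. f n)"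
    proof (induction rule: converse_tranclp_induct)
      case (base y)
      then have "y \<in> f 0" by (simp add: f_def)
      then show ?case by blast
    next
      case (step y z)
      then obtain n where "z \<in> f n" by blast
      with step have "y \<in> f (Suc n)" by (auto simp: f_def)
      then show ?case by blast
    qed
  qed
  ultimately show ?thesis by (rule small_subset)
qed

section \<open>Large regular cardinals\<close>

text \<open>The successor of an infinite cardinal is regular. It remains to realise it by an element
  of the universe, which works because it embeds into the power set of \<open>X\<close>.\<close>

lemma ex_regular_cardinal_greater:
  assumes "small X" "infinite X"
  obtains \<theta> where "regular_cardinal \<theta>" "|X| <o |ext \<theta>|"
proof -
  let ?r = "cardSuc |X|"
  have co: "Card_order ?r" by (rule cardSuc_Card_order[OF card_of_Card_order])
  have sub: "small Y" if "Y \<in> Pow X" for Y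
    using small_subset[OF \<open>small X\<close>] that by blast
  have "ext (mk Y) \<subseteq> X" if "Y \<in> Pow X" for Y
    using sub[OF that] that by simp
  then have "mk ` Pow X \<subseteq> {y. ext y \<subseteq> X}" by blast
  then have small: "small (mk ` Pow X)" by (rule small_subset[OF small_Pow[OF \<open>small X\<close>]])
  have inj: "inj_on mk (Pow X)"
    by (rule inj_on_inverseI[of _ ext]) (simp add: sub)
  have "?r \<le>o |Pow X|"
    by (rule cardSuc_least[OF card_of_Card_order card_of_Card_order card_of_Pow])
  then have "|Field ?r| \<le>o |Pow X|"
    by (rule ordIso_ordLeq_trans[OF card_of_Field_ordIso[OF co]])
  then obtain h where h: "inj_on h (Field ?r)" "h ` Field ?r \<subseteq> Pow X"
    using card_of_ordLeq[of "Field ?r" "Pow X"] by blast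
  \<comment> \<open>The map \<open>h\<close> goes to subsets of \<open>X\<close>, and
    \<open>mk\<close> codes these as elements of the universe. The range is small as a subset of the
    power set.\<close>
  define \<theta> where "\<theta> = mk ((mk \<circ> h) ` Field ?r)"
  have "(mk \<circ> h) ` Field ?r \<subseteq> mk ` Pow X" using h by auto
  then have \<theta>: "ext \<theta> = (mk \<circ> h) ` Field ?r"
    unfolding \<theta>_def using small_subset[OF small] by simp
  have "inj_on (mk \<circ> h) (Field ?r)"
    using h inj by (meson comp_inj_on inj_on_subset)
  then have "|Field ?r| =o |ext \<theta>|"
    using \<theta> by (intro card_of_ordIsoI[of "mk \<circ> h"]) (simp add: bij_betw_def)
  then have iso: "?r =o |ext \<theta>|"
    by (rule ordIso_transitive[OF ordIso_symmetric[OF card_of_Field_ordIso[OF co]]])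
  have less: "|X| <o |ext \<theta>|"
    by (rule ordLess_ordIso_trans[OF cardSuc_greater[OF card_of_Card_order] iso])
  have "infinite (ext \<theta>)"
    by (rule card_of_ordLeq_infinite[OF ordLess_imp_ordLeq[OF less] \<open>infinite X\<close>])
  moreover have "regularCard ?r"
    using \<open>infinite X\<close> by (intro infinite_cardSuc_regularCard[OF _ card_of_Card_order]) (simp add: Field_card_of)
  then have "regularCard |ext \<theta>|"
    using \<open>infinite X\<close> co cardSuc_finite[OF card_of_Card_order, of X]
    by (intro regularCard_ordIso[OF iso]) (simp_all add: cinfinite_def Field_card_of)
  ultimately show ?thesis using less that regular_cardinal_def by blast
qed

section \<open>Ordered pairs, carriers and the classes \<open>H \<theta>\<close>\<close>

lemma mk_inject: "small X \<Longrightarrow> small Y \<Longrightarrow> mk X = mk Y \<longleftrightarrow> X = Y"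
  by (metis ext_mk)

lemma small_singleton: "small {x}"
  using small_pair[of x x] by simp

lemma is_upair_iff: "is_upair w x y \<longleftrightarrow> w = mk {x, y}"
proof -
  have "is_upair w x y \<longleftrightarrow> ext w = ext (mk {x, y})"
    by (simp add: is_upair_def set_eq_iff ext_mk[OF small_pair])
  then show ?thesis by (simp only: ext_inject)
qed

lemma is_pair_iff: "is_pair z x y \<longleftrightarrow> z = mk {mk {x}, mk {x, y}}"
proof -
  have "is_pair z x y \<longleftrightarrow> ext z = ext (mk {mk {x}, mk {x, y}})"
    by (simp add: is_pair_def is_upair_iff set_eq_iff ext_mk[OF small_pair])
  then show ?thesis by (simp only: ext_inject)
qed

lemma is_pair_inject: "is_pair z x y \<Longrightarrow> is_pair z x' y' \<Longrightarrow> x = x' \<and> y = y'"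
  by (auto simp: is_pair_iff mk_inject small_pair small_singleton doubleton_eq_iff)

lemma small_pairs:
  assumes "small X"
  shows "small {z. \<exists>x y. is_pair z x y \<and> x \<in> X \<and> y \<in> X}"
proof -
  have "small (\<Union>x\<in>X. (\<lambda>y. mk {mk {x}, mk {x, y}}) ` X)"
    by (rule small_UN[OF assms small_image[OF assms]])
  moreover have "{z. \<exists>x y. is_pair z x y \<and> x \<in> X \<and> y \<in> X} =
      (\<Union>x\<in>X. (\<lambda>y. mk {mk {x}, mk {x, y}}) ` X)"
    by (auto simp: is_pair_iff)
  ultimately show ?thesis by simp
qed

text \<open>A Kuratowski pair of \<open>p\<close> with itself contains the singleton of
  \<open>p\<close>, so the carrier lies in the union of the union of \<open>P\<close>.\<close>

lemma small_carrier: "small {p. el P p}"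
proof -
  have "small (\<Union>z\<in>ext P. \<Union>y\<in>ext z. ext y)"
    by (intro small_UN small_ext)
  moreover have "{p. el P p} \<subseteq> (\<Union>z\<in>ext P. \<Union>y\<in>ext z. ext y)"
  proof clarify
    fix p assume "el P p"
    then obtain z where z: "z \<epsilon> P" "is_pair z p p" by (auto simp: el_def le_def)
    have "mk {p} \<in> ext z" using z(2) by (simp add: is_pair_iff ext_mk[OF small_singleton] del: mem_ext)
    moreover have "p \<in> ext (mk {p})" by (simp add: ext_mk[OF small_singleton] del: mem_ext)
    ultimately show "p \<in> (\<Union>z\<in>ext P. \<Union>y\<in>ext z. ext y)" using z(1)
      by (auto simp del: mem_ext simp: ext_def[of P])
  qed
  ultimately show ?thesis by (rule small_subset)
qed

lemma H_transitive:
  assumes "x \<in> H \<theta>" "y \<epsilon> x"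
  shows "y \<in> H \<theta>"
proof -
  have "{z. mem\<^sup>+\<^sup>+ z y} \<subseteq> {z. mem\<^sup>+\<^sup>+ z x}"
    using assms(2) by (auto intro: tranclp.trancl_into_trancl)
  then have "|{z. mem\<^sup>+\<^sup>+ z y}| \<le>o |{z. mem\<^sup>+\<^sup>+ z x}|" by (rule card_of_mono1)
  moreover have "|{z. mem\<^sup>+\<^sup>+ z x}| <o |ext \<theta>|" using assms(1) by (simp add: H_def)
  ultimately show ?thesis unfolding H_def by (simp add: ordLeq_ordLess_trans)
qed

end

section \<open>The regular open algebra\<close>

locale poset_universe = set_universe +
  fixes P
  assumes poset: "poset P"
begin

lemma le_el: "le P p q \<Longrightarrow> el P p" "le P p q \<Longrightarrow> el P q"
proof -
  have "\<forall>x y. le P x y \<longrightarrow> el P x \<and> el P y" using poset unfolding poset_def by (elim conjE)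
  then show "le P p q \<Longrightarrow> el P p" "le P p q \<Longrightarrow> el P q" by blast+
qed

lemma le_refl: "el P p \<Longrightarrow> le P p p"
  by (simp add: el_def)

lemma le_trans: "le P p q \<Longrightarrow> le P q r \<Longrightarrow> le P p r"
proof -
  have "\<forall>x y z. le P x y \<and> le P y z \<longrightarrow> le P x z" using poset unfolding poset_def by (elim conjE)
  then show "le P p q \<Longrightarrow> le P q r \<Longrightarrow> le P p r" by blast
qed

text \<open>This is the interior of the closure of \<open>X\<close> only if \<open>X\<close> is downward closed.\<close>

definition reg :: "'a set \<Rightarrow> 'a set" where
  "reg X = {p. el P p \<and> (\<forall>q. le P q p \<longrightarrow> (\<exists>r. le P r q \<and> r \<in> X))}"

lemma regular_open_iff: "regular_open P U \<longleftrightarrow> reg (ext U) = ext U"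
proof -
  have "regular_open P U \<longleftrightarrow> ext U = reg (ext U)"
    by (simp only: regular_open_def set_eq_iff reg_def mem_Collect_eq mem_ext)
  then show ?thesis by (rule trans) (rule eq_commute)
qed

lemma reg_mono: "X \<subseteq> Y \<Longrightarrow> reg X \<subseteq> reg Y"
  unfolding reg_def by blast

lemma reg_down: "p \<in> reg X \<Longrightarrow> le P q p \<Longrightarrow> q \<in> reg X"
  using le_el(1)[of q p] le_trans[of _ q p] by (simp add: reg_def)

text \<open>Two successive extensions are one by transitivity, and \<open>reg X\<close> is downward
  closed. This holds for every \<open>X\<close>, so \<open>mk (reg X)\<close> is always regular
  open.\<close>

lemma reg_reg: "reg (reg X) = reg X"
proof (intro equalityI subsetI)
  fix p assume p: "p \<in> reg (reg X)"
  show "p \<in> reg X"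
    unfolding reg_def
  proof (clarify, intro conjI allI impI)
    show "el P p" using p by (simp add: reg_def)
    fix q assume "le P q p"
    then obtain r where r: "le P r q" "r \<in> reg X" using p unfolding reg_def by blast
    then have "le P r r" using le_el le_refl by blast
    with r obtain s where "le P s r" "s \<in> X" unfolding reg_def by blast
    then show "\<exists>r. le P r q \<and> r \<in> X" using r le_trans by blast
  qed
next
  fix p assume p: "p \<in> reg X"
  then have "el P p" by (simp add: reg_def)
  moreover have "\<exists>r. le P r q \<and> r \<in> reg X" if "le P q p" for q
    using reg_down[OF p that] le_refl[OF le_el(1)[OF that]] by blast
  ultimately show "p \<in> reg (reg X)" by (subst reg_def) blast
qed

lemma subset_reg:
  assumes "\<And>p q. p \<in> X \<Longrightarrow> le P q p \<Longrightarrow> q \<in> X" "\<And>p. p \<in> X \<Longrightarrow> el P p"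
  shows "X \<subseteq> reg X"
proof
  fix p assume "p \<in> X"
  moreover have "\<exists>r. le P r q \<and> r \<in> X" if "le P q p" for q
    using assms(1)[OF \<open>p \<in> X\<close> that] le_refl[OF le_el(1)[OF that]] by blast
  ultimately show "p \<in> reg X" using assms(2) by (simp add: reg_def)
qed

lemma small_reg: "small (reg X)"
  by (rule small_subset[OF small_carrier[of P]]) (unfold reg_def, blast)

lemma ext_mk_reg: "ext (mk (reg X)) = reg X"
  by (rule ext_mk[OF small_reg])

lemma regular_open_mk_reg: "regular_open P (mk (reg X))"
  unfolding regular_open_iff ext_mk_reg by (rule reg_reg)

lemma regular_open_down: "regular_open P U \<Longrightarrow> p \<in> ext U \<Longrightarrow> le P q p \<Longrightarrow> q \<in> ext U"
  using reg_down[of p "ext U" q] unfolding regular_open_iff by simp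

lemma regular_open_el: "regular_open P U \<Longrightarrow> p \<in> ext U \<Longrightarrow> el P p"
  unfolding regular_open_iff by (metis (no_types, lifting) reg_def mem_Collect_eq)

lemma small_regular_open: "small {U. regular_open P U}"
  by (rule small_subset[OF small_Pow[OF small_carrier[of P]]]) (use regular_open_el in blast)

section \<open>The Boolean structure of \<open>RO P\<close>\<close>

lemma mem_RO: "z \<epsilon> RO P \<longleftrightarrow>
  (\<exists>U W. is_pair z U W \<and> regular_open P U \<and> regular_open P W \<and> ext U \<subseteq> ext W)"
proof -
  let ?Z = "{z. \<exists>U W. is_pair z U W \<and> regular_open P U \<and> regular_open P W \<and> ext U \<subseteq> ext W}"
  have "small ?Z"
    by (rule small_subset[OF small_pairs[OF small_regular_open]]) auto
  then have "ext (RO P) = ?Z" unfolding RO_def setof_eq_mk by (rule ext_mk)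
  then have "z \<in> ext (RO P) \<longleftrightarrow> z \<in> ?Z" by (rule arg_cong)
  then show ?thesis by simp
qed

lemma le_RO: "le (RO P) U W \<longleftrightarrow> regular_open P U \<and> regular_open P W \<and> ext U \<subseteq> ext W"
proof
  assume "le (RO P) U W"
  then obtain z U' W' where "is_pair z U W" "is_pair z U' W'"
    "regular_open P U'" "regular_open P W'" "ext U' \<subseteq> ext W'"
    by (auto simp: le_def mem_RO)
  then show "regular_open P U \<and> regular_open P W \<and> ext U \<subseteq> ext W"
    using is_pair_inject by metis
next
  assume "regular_open P U \<and> regular_open P W \<and> ext U \<subseteq> ext W"
  moreover have "is_pair (mk {mk {U}, mk {U, W}}) U W" by (simp add: is_pair_iff)
  ultimately show "le (RO P) U W" unfolding le_def mem_RO by blast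
qed

lemma el_RO: "el (RO P) U \<longleftrightarrow> regular_open P U"
  by (simp add: el_def le_RO)

lemma is_zero_RO: "is_zero (RO P) U \<longleftrightarrow> ext U = {}"
proof -
  have empty: "reg {} = {}" using le_refl unfolding reg_def by blast
  show ?thesis
  proof
    assume "is_zero (RO P) U"
    then have "le (RO P) U (mk (reg {}))"
      using regular_open_mk_reg unfolding is_zero_def el_RO by blast
    then have "ext U \<subseteq> reg {}" unfolding le_RO ext_mk_reg by blast
    then show "ext U = {}" using empty by blast
  next
    assume U: "ext U = {}"
    then have "regular_open P U" by (simp add: regular_open_iff empty)
    then show "is_zero (RO P) U" using U by (simp add: is_zero_def le_RO el_RO)
  qed
qed

lemma is_one_RO: "is_one (RO P) U \<longleftrightarrow> ext U = {p. el P p}"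
proof -
  have all: "reg {p. el P p} = {p. el P p}"
    unfolding reg_def using le_refl le_el(1) by blast
  show ?thesis
  proof
    assume "is_one (RO P) U"
    then have "regular_open P U" "ext (mk (reg {p. el P p})) \<subseteq> ext U"
      using regular_open_mk_reg by (simp_all add: is_one_def le_RO el_RO)
    moreover have "ext (mk (reg {p. el P p})) = {p. el P p}" unfolding ext_mk_reg by (rule all)
    ultimately show "ext U = {p. el P p}" using regular_open_el[of U] by blast
  next
    assume U: "ext U = {p. el P p}"
    then have "regular_open P U" by (simp add: regular_open_iff all)
    moreover have "ext W \<subseteq> ext U" if "regular_open P W" for W
      using regular_open_el[OF that] U by blast
    ultimately show "is_one (RO P) U" by (simp add: is_one_def le_RO el_RO)
  qed
qed

lemma reg_Int:
  assumes "regular_open P U" "regular_open P W"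
  shows "reg (ext U \<inter> ext W) = ext U \<inter> ext W"
proof
  have "reg (ext U \<inter> ext W) \<subseteq> ext U" "reg (ext U \<inter> ext W) \<subseteq> ext W"
    using reg_mono[of "ext U \<inter> ext W" "ext U"] reg_mono[of "ext U \<inter> ext W" "ext W"] assms
    by (simp_all add: regular_open_iff)
  then show "reg (ext U \<inter> ext W) \<subseteq> ext U \<inter> ext W" by (rule Int_greatest)
  show "ext U \<inter> ext W \<subseteq> reg (ext U \<inter> ext W)"
  proof (rule subset_reg)
    show "q \<in> ext U \<inter> ext W" if "p \<in> ext U \<inter> ext W" "le P q p" for p q
      using that regular_open_down[OF assms(1), of p q] regular_open_down[OF assms(2), of p q] by blast
    show "el P p" if "p \<in> ext U \<inter> ext W" for p
      using that regular_open_el[OF assms(1), of p] by blast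
  qed
qed

lemma is_meet_RO:
  "is_meet (RO P) U W V \<longleftrightarrow> regular_open P U \<and> regular_open P W \<and> ext V = ext U \<inter> ext W"
proof
  assume m: "is_meet (RO P) U W V"
  then have UW: "regular_open P U" "regular_open P W" by (simp_all add: is_meet_def le_RO)
  let ?I = "mk (reg (ext U \<inter> ext W))"
  have I: "ext ?I = ext U \<inter> ext W" unfolding ext_mk_reg by (rule reg_Int[OF UW])
  have "le (RO P) ?I U \<and> le (RO P) ?I W"
    using UW regular_open_mk_reg by (simp add: le_RO I)
  then have "le (RO P) ?I V" using m unfolding is_meet_def by blast
  then have "ext U \<inter> ext W \<subseteq> ext V" unfolding le_RO I by blast
  moreover have "ext V \<subseteq> ext U \<inter> ext W" using m by (simp add: is_meet_def le_RO)
  ultimately show "regular_open P U \<and> regular_open P W \<and> ext V = ext U \<inter> ext W" using UW by blast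
next
  assume "regular_open P U \<and> regular_open P W \<and> ext V = ext U \<inter> ext W"
  moreover from this have "regular_open P V" using reg_Int[of U W] by (simp add: regular_open_iff)
  ultimately show "is_meet (RO P) U W V" by (auto simp: is_meet_def le_RO)
qed

lemma Un_subset_reg:
  assumes "\<And>U. U \<in> S \<Longrightarrow> regular_open P U"
  shows "(\<Union>U\<in>S. ext U) \<subseteq> reg (\<Union>U\<in>S. ext U)"
proof (rule subset_reg)
  show "q \<in> (\<Union>U\<in>S. ext U)" if "p \<in> (\<Union>U\<in>S. ext U)" "le P q p" for p q
    using that regular_open_down[OF assms, of _ p q] by blast
  show "el P p" if "p \<in> (\<Union>U\<in>S. ext U)" for p
    using that regular_open_el[OF assms, of _ p] by blast
qed

text \<open>A union of open sets is open and hence contained in its regularization; a regular open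
  upper bound is fixed by \<open>reg\<close>, so it contains the regularization by
  monotonicity.\<close>

lemma is_lub_RO:
  assumes "sub S (RO P)"
  shows "is_lub (RO P) S (mk (reg (\<Union>U\<in>ext S. ext U)))"
proof -
  let ?s = "reg (\<Union>U\<in>ext S. ext U)"
  have S: "regular_open P U" if "U \<in> ext S" for U
    using assms that by (simp add: sub_def el_RO)
  have "ext U \<subseteq> ?s" if "U \<in> ext S" for U
    using Un_subset_reg[OF S] that by blast
  moreover have "?s \<subseteq> ext W" if "regular_open P W" "\<And>U. U \<in> ext S \<Longrightarrow> ext U \<subseteq> ext W" for W
    using reg_mono[of "\<Union>U\<in>ext S. ext U" "ext W"] that unfolding regular_open_iff by blast
  ultimately show ?thesis
    using S regular_open_mk_reg by (simp add: is_lub_def el_RO le_RO ext_mk_reg)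
qed

lemma is_join_RO:
  "is_join (RO P) U W V \<longleftrightarrow> regular_open P U \<and> regular_open P W \<and> ext V = reg (ext U \<union> ext W)"
\<comment> \<open>Both sides fail unless \<open>U\<close> and \<open>W\<close> are regular open,
  because the order of \<open>RO P\<close> relates only such sets.\<close>
proof (cases "regular_open P U \<and> regular_open P W")
  case True
  let ?J = "mk (reg (ext U \<union> ext W))"
  have "ext U \<union> ext W \<subseteq> reg (ext U \<union> ext W)"
    using Un_subset_reg[of "{U, W}"] True by auto
  moreover have least: "reg (ext U \<union> ext W) \<subseteq> ext X"
    if "regular_open P X" "ext U \<subseteq> ext X" "ext W \<subseteq> ext X" for X
    using reg_mono[of "ext U \<union> ext W" "ext X"] that unfolding regular_open_iff by blast
  ultimately have J: "is_join (RO P) U W ?J"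
    using True regular_open_mk_reg by (simp add: is_join_def le_RO ext_mk_reg)
  have "ext V = reg (ext U \<union> ext W) \<longleftrightarrow> V = ?J"
    using ext_mk_reg ext_inject by metis
  moreover have "V = ?J" if "is_join (RO P) U W V"
  proof -
    have "ext V = ext ?J" using J that by (simp add: is_join_def le_RO subset_antisym)
    then show ?thesis by (simp only: ext_inject)
  qed
  ultimately show ?thesis using J True by blast
qed (auto simp: is_join_def le_RO)

text \<open>The complement \<open>?C\<close> consists of the conditions without extension in
  \<open>U\<close>. It is regular: if \<open>p\<close> had an extension in \<open>U\<close>, then
  everything below that extension would stay in \<open>U\<close> and avoid
  \<open>?C\<close>.\<close>

lemma ex_compl_RO:
  assumes U: "regular_open P U"
  shows "\<exists>W. is_compl (RO P) U W"
proof -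
  let ?C = "{p. el P p \<and> (\<forall>q. le P q p \<longrightarrow> q \<notin> ext U)}"
  have "?C \<subseteq> reg ?C"
    by (rule subset_reg) (use le_trans le_el in blast)+
  moreover have "reg ?C \<subseteq> ?C"
  proof clarify
    fix p assume p: "p \<in> reg ?C"
    have "q \<notin> ext U" if "le P q p" for q
    proof
      assume q: "q \<in> ext U"
      obtain r where r: "le P r q" "r \<in> ?C" using p \<open>le P q p\<close> unfolding reg_def by blast
      then have "r \<in> ext U" using regular_open_down[OF U q] by blast
      with r show False using le_refl by blast
    qed
    moreover have "el P p" using p by (simp add: reg_def)
    ultimately show "el P p \<and> (\<forall>q. le P q p \<longrightarrow> q \<notin> ext U)" by blast
  qed
  ultimately have C: "reg ?C = ?C" by blast
  have "ext (mk (reg ?C)) = ?C" unfolding ext_mk_reg by (rule C)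
  then obtain W where W: "regular_open P W" "ext W = ?C"
    using regular_open_mk_reg by blast
  have disj: "ext U \<inter> ext W = {}" using W(2) le_refl by blast
  have "el P p \<Longrightarrow> p \<in> reg (ext U \<union> ext W)" for p
  proof -
    \<comment> \<open>The union is dense: either \<open>q\<close> has an extension in
      \<open>U\<close>, or \<open>q\<close> itself is in \<open>?C\<close>.\<close>
    have "\<exists>r. le P r q \<and> r \<in> ext U \<union> ?C" if "le P q p" for q
      using le_refl[OF le_el(1)[OF that]] le_el(1)[OF that] by blast
    then show "el P p \<Longrightarrow> p \<in> reg (ext U \<union> ext W)" unfolding W(2) reg_def by blast
  qed
  then have all: "reg (ext U \<union> ext W) = {p. el P p}" by (auto simp: reg_def)
  have "ext (mk {}) = {}" using ext_mk[OF small_subset[OF small_ext]] by blast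
  then have "is_zero (RO P) (mk {}) \<and> is_meet (RO P) U W (mk {})"
    using U W(1) disj by (simp only: is_zero_RO is_meet_RO)
  moreover have "ext (mk {p. el P p}) = {p. el P p}" by (rule ext_mk[OF small_carrier])
  then have "is_one (RO P) (mk {p. el P p}) \<and> is_join (RO P) U W (mk {p. el P p})"
    using U W(1) all by (simp only: is_one_RO is_join_RO)
  ultimately show ?thesis unfolding is_compl_def by blast
qed

lemma cba_RO:
  assumes "el P p0"
  shows "cba (RO P)"
  unfolding cba_def
proof (intro conjI)
  show "poset (RO P)"
    unfolding poset_def el_RO le_RO
    using mem_RO ext_inject by (auto simp: subset_antisym)
  show "\<forall>S. sub S (RO P) \<longrightarrow> (\<exists>s. is_lub (RO P) S s)" using is_lub_RO by blast
  show "\<forall>x. el (RO P) x \<longrightarrow> (\<exists>y. is_compl (RO P) x y)" using ex_compl_RO el_RO by blast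
  show "\<not> (\<exists>x. is_zero (RO P) x \<and> is_one (RO P) x)"
    using assms by (auto simp: is_zero_RO is_one_RO)
  show "\<forall>x y z j m a b k. is_join (RO P) y z j \<and> is_meet (RO P) x j m \<and>
      is_meet (RO P) x y a \<and> is_meet (RO P) x z b \<and> is_join (RO P) a b k \<longrightarrow> m = k"
  proof (intro allI impI, elim conjE)
    fix x y z j m a b k
    assume "is_join (RO P) y z j" "is_meet (RO P) x j m" "is_meet (RO P) x y a"
      "is_meet (RO P) x z b" "is_join (RO P) a b k"
    then have ro: "regular_open P x" "regular_open P j" "regular_open P y" "regular_open P z"
      and j: "ext j = reg (ext y \<union> ext z)" and m: "ext m = ext x \<inter> ext j"
      and k: "ext k = reg (ext x \<inter> ext y \<union> ext x \<inter> ext z)"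
      by (auto simp: is_join_RO is_meet_RO)
    have "ext k \<subseteq> ext m"
      using reg_mono[of "ext x \<inter> ext y \<union> ext x \<inter> ext z" "ext x"]
        reg_mono[of "ext x \<inter> ext y \<union> ext x \<inter> ext z" "ext y \<union> ext z"] ro(1)
      unfolding k m j regular_open_iff by blast
    \<comment> \<open>This is the inclusion with content. Below a point of \<open>x\<close> in the
      regularization there are points of \<open>y\<close> or \<open>z\<close>, and these remain in
      \<open>x\<close>, which is downward closed.\<close>
    moreover have "ext m \<subseteq> ext k"
    proof
      fix p assume "p \<in> ext m"
      then have p: "p \<in> ext x" "p \<in> reg (ext y \<union> ext z)" using m j by blast+
      have "\<exists>r. le P r q \<and> r \<in> ext x \<inter> ext y \<union> ext x \<inter> ext z" if "le P q p" for q
      proof -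
        obtain r where r: "le P r q" "r \<in> ext y \<union> ext z"
          using p(2) \<open>le P q p\<close> unfolding reg_def by blast
        moreover have "r \<in> ext x" using regular_open_down[OF ro(1) p(1)] le_trans r(1) that by blast
        ultimately show ?thesis by blast
      qed
      then show "p \<in> ext k" using regular_open_el[OF ro(1) p(1)] unfolding k reg_def by blast
    qed
    ultimately have "ext m = ext k" by blast
    then show "m = k" by (simp only: ext_inject)
  qed
qed

section \<open>Suprema of sets of conditions\<close>

text \<open>The supremum in \<open>RO P\<close> of the images of the elements of \<open>S\<close>:
  the open set generated by \<open>S\<close>, regularized. For a singleton it is
  \<open>ro_embed\<close>.\<close>

definition join_of :: "'a set \<Rightarrow> 'a" where
  "join_of S = mk (reg {p. \<exists>a\<in>S. le P p a})"

lemma regular_open_join_of: "regular_open P (join_of S)"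
  unfolding join_of_def by (rule regular_open_mk_reg)

lemma ext_join_of: "ext (join_of S) = {p. el P p \<and> (\<forall>q. le P q p \<longrightarrow> (\<exists>a\<in>S. compatible P q a))}"
  unfolding join_of_def ext_mk_reg unfolding reg_def compatible_def by blast

lemma ro_embed_le_join_of:
  assumes "a \<in> S"
  shows "le (RO P) (ro_embed P a) (join_of S)"
proof -
  have "ro_embed P a = mk (ext (join_of {a}))"
    unfolding ro_embed_def setof_eq_mk ext_join_of by simp
  then have "ro_embed P a = join_of {a}" by simp
  then show ?thesis
    using assms regular_open_join_of by (auto simp: le_RO ext_join_of)
qed

lemma join_of_nonempty:
  assumes "a \<in> S" "el P a"
  shows "ext (join_of S) \<noteq> {}"
proof -
  have "a \<in> ext (join_of S)"
    using assms le_refl le_el unfolding ext_join_of compatible_def by blast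
  then show ?thesis by blast
qed

text \<open>A common element \<open>p\<close> could be extended below some \<open>a\<close> in
  \<open>S\<close>, and the result further below some \<open>b\<close> in \<open>T\<close>, which
  would make \<open>a\<close> and \<open>b\<close> compatible.\<close>

lemma join_of_disjoint:
  assumes "\<And>a b. a \<in> S \<Longrightarrow> b \<in> T \<Longrightarrow> \<not> compatible P a b"
  shows "ext (join_of S) \<inter> ext (join_of T) = {}"
proof (rule ccontr)
  assume "\<not> ?thesis"
  then obtain p where p: "p \<in> ext (join_of S)" "p \<in> ext (join_of T)" by blast
  then have "le P p p" using le_refl unfolding ext_join_of by blast
  with p obtain a r where r: "a \<in> S" "le P r p" "le P r a"
    unfolding ext_join_of compatible_def by blast
  with p obtain b s where "b \<in> T" "le P s r" "le P s b"
    unfolding ext_join_of compatible_def by blast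
  with r have "compatible P a b" unfolding compatible_def using le_trans by blast
  with assms r \<open>b \<in> T\<close> show False by blast
qed

section \<open>From an uncountable antichain in \<open>P\<close> to one in \<open>F\<close>\<close>

lemma ccc_if_Phi_cc:
  assumes no_uncountable: "\<And>B F A. cba B \<Longrightarrow> sub F B \<Longrightarrow> holds \<Phi> F B \<Longrightarrow>
      ext A \<subseteq> ext F \<Longrightarrow> ba_antichain B A \<Longrightarrow> countable (ext A)"
    and cc: "Phi_cc \<Phi> P"
  shows "ccc P"
  unfolding ccc_def
proof (intro allI impI, elim conjE, rule ccontr)
  fix A
  assume "sub A P" and incomp: "\<forall>x y. x \<epsilon> A \<and> y \<epsilon> A \<and> x \<noteq> y \<longrightarrow> \<not> compatible P x y"
    and "uncountable (ext A)"
  then have elA: "el P a" if "a \<in> ext A" for a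
    using that by (simp add: sub_def)
  obtain J and S :: "'a \<Rightarrow> nat \<Rightarrow> 'a set" where J: "J \<subseteq> ext A" "uncountable J"
    and SJ: "\<And>\<alpha> n. S \<alpha> n \<subseteq> J"
    and cover: "\<And>\<alpha>. \<alpha> \<in> J \<Longrightarrow> countable (J - (\<Union>n. S \<alpha> n))"
    and disj: "\<And>\<alpha> \<beta> n. \<alpha> \<in> J \<Longrightarrow> \<beta> \<in> J \<Longrightarrow> \<alpha> \<noteq> \<beta> \<Longrightarrow> S \<alpha> n \<inter> S \<beta> n = {}"
    using Ulam_matrix[OF \<open>uncountable (ext A)\<close>] by metis
  have elJ: "el P a" if "a \<in> J" for a using elA J(1) that by blast
  \<comment> \<open>Empty entries are left out because their supremum is zero, which is not allowed
    in an antichain. Each row is countable and therefore a set.\<close>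
  define row where "row \<alpha> = (\<lambda>n. join_of (S \<alpha> n)) ` {n. S \<alpha> n \<noteq> {}}" for \<alpha>
  have row: "ext (mk (row \<alpha>)) = row \<alpha>" "countable (row \<alpha>)" for \<alpha>
    by (simp_all add: row_def small_countable)
  define R where "R = mk ((\<lambda>\<alpha>. mk (row \<alpha>)) ` J)"
  have R: "ext R = (\<lambda>\<alpha>. mk (row \<alpha>)) ` J"
    unfolding R_def by (rule ext_mk[OF small_image[OF small_subset[OF small_ext J(1)]]])
  obtain bound where bound: "\<forall>\<theta>. regular_cardinal \<theta> \<and> |ext bound| <o |ext \<theta>| \<longrightarrow>
      (\<forall>q M. el P q \<and> countable (ext M) \<and> elementary mem (ext M) (H \<theta>) \<and> P \<epsilon> M \<longrightarrow>
        (\<exists>F. F \<epsilon> M \<and> sub F (RO P) \<and> holds \<Phi> F (RO P) \<and>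
          (\<forall>p. el (RO P) p \<and> p \<epsilon> M \<and> le (RO P) (ro_embed P q) p \<longrightarrow> p \<epsilon> F)))"
    using cc unfolding Phi_cc_def by (rule exE)
  obtain w where w: "infinite (ext w)" using ex_infinite_set by blast
  \<comment> \<open>A cardinal above \<open>|X|\<close> exceeds the given bound and puts
    \<open>P\<close> and \<open>R\<close> into \<open>H \<theta>\<close>; the part from
    \<open>w\<close> makes \<open>X\<close> infinite, as the existence of a regular \<theta>
    requires.\<close>
  define X where "X = (ext bound \<union> ext w) \<union> ({y. mem\<^sup>+\<^sup>+ y P} \<union> {y. mem\<^sup>+\<^sup>+ y R})"
  have "small X"
    unfolding X_def by (intro small_Un small_ext small_transitive_closure)
  moreover have "infinite X" using w by (simp add: X_def)
  ultimately obtain \<theta> where \<theta>: "regular_cardinal \<theta>" "|X| <o |ext \<theta>|"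
    by (rule ex_regular_cardinal_greater)
  have X: "|Y| <o |ext \<theta>|" if "Y \<subseteq> X" for Y
    by (rule ordLeq_ordLess_trans[OF card_of_mono1[OF that] \<theta>(2)])
  have inH: "P \<in> H \<theta>" "R \<in> H \<theta>"
    unfolding H_def by (auto intro!: X simp: X_def)
  \<comment> \<open>Closing \<open>M\<close> under these enumerations makes every countable element of \<open>M\<close> a subset of \<open>M\<close>.\<close>
  define c where "c n x = (if ext x \<noteq> {} \<and> countable (ext x) then from_nat_into (ext x) n else x)"
    for n x
  have cH: "c n x \<in> H \<theta>" if "x \<in> H \<theta>" for n x
  proof (cases "ext x \<noteq> {} \<and> countable (ext x)")
    case True
    then have "c n x \<in> ext x" unfolding c_def using from_nat_into by metis
    then show ?thesis using H_transitive[OF that] by simp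
  next
    case False
    then show ?thesis unfolding c_def using that by metis
  qed
  obtain M0 where M0: "countable M0" "{P, R} \<subseteq> M0" "elementary mem M0 (H \<theta>)"
    and closed: "\<And>n x. x \<in> M0 \<Longrightarrow> c n x \<in> M0"
    by (rule countable_elementary_submodel[of "{P, R}" "H \<theta>" c mem]) (use inH cH in auto)
  define M where "M = mk M0"
  have M: "ext M = M0" unfolding M_def by (rule ext_mk[OF small_countable[OF M0(1)]])
  have mem_M: "x \<epsilon> M \<longleftrightarrow> x \<in> M0" for x using M mem_ext by blast
  have countable_sub_M: "ext x \<subseteq> M0" if x: "x \<in> M0" "countable (ext x)" for x
  proof
    fix y assume "y \<in> ext x"
    then obtain n where "y = from_nat_into (ext x) n" using from_nat_into_surj[OF x(2)] by metis
    then have "y = c n x" using x(2) \<open>y \<in> ext x\<close> unfolding c_def by (metis empty_iff)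
    then show "y \<in> M0" using closed[OF x(1)] by simp
  qed
  have "\<forall>r\<in>M0 \<inter> ext R. \<exists>\<alpha>. \<alpha> \<in> J \<and> r = mk (row \<alpha>)" using R by blast
  then obtain \<alpha> where \<alpha>: "\<And>r. r \<in> M0 \<inter> ext R \<Longrightarrow> \<alpha> r \<in> J \<and> r = mk (row (\<alpha> r))"
    by metis
  \<comment> \<open>Countably many rows lie in \<open>M\<close>, and each misses only countably many
    points of \<open>J\<close>. So some \<open>q\<close> in the uncountable \<open>J\<close> is
    covered by all of them.\<close>
  have "countable (\<Union>r\<in>M0 \<inter> ext R. J - (\<Union>n. S (\<alpha> r) n))"
    using M0(1) cover \<alpha> by (intro countable_UN) auto
  then obtain q where q: "q \<in> J" "q \<notin> (\<Union>r\<in>M0 \<inter> ext R. J - (\<Union>n. S (\<alpha> r) n))"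
    using J(2) by (metis countable_subset subsetI)
  have "\<exists>F. F \<epsilon> M \<and> sub F (RO P) \<and> holds \<Phi> F (RO P) \<and>
        (\<forall>p. el (RO P) p \<and> p \<epsilon> M \<and> le (RO P) (ro_embed P q) p \<longrightarrow> p \<epsilon> F)"
  proof (rule bound[rule_format])
    have "|ext bound| <o |ext \<theta>|" by (rule X) (unfold X_def, blast)
    then show "regular_cardinal \<theta> \<and> |ext bound| <o |ext \<theta>|" using \<theta>(1) by simp
    show "el P q \<and> countable (ext M) \<and> elementary mem (ext M) (H \<theta>) \<and> P \<epsilon> M"
      using elJ[OF q(1)] M0 by (simp add: M mem_M)
  qed
  then obtain F where F: "F \<in> M0" "sub F (RO P)" "holds \<Phi> F (RO P)"
    and above: "\<And>p. regular_open P p \<Longrightarrow> p \<in> M0 \<Longrightarrow> le (RO P) (ro_embed P q) p \<Longrightarrow> p \<epsilon> F"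
    unfolding mem_M el_RO by blast
  \<comment> \<open>The entry of \<open>r\<close> containing \<open>q\<close> has a supremum above
    \<open>q\<close>. This supremum is in \<open>M\<close>, since \<open>r\<close> is a countable
    element of \<open>M\<close>, and so the choice of \<open>F\<close> puts it into
    \<open>F\<close>.\<close>
  have hit: "\<exists>x\<in>M0. x \<epsilon> r \<and> x \<epsilon> F" if r: "r \<in> M0" "r \<epsilon> R" for r
  proof -
    have rR: "r \<in> M0 \<inter> ext R" using r by simp
    then obtain n where n: "q \<in> S (\<alpha> r) n" using q by blast
    have er: "ext r = row (\<alpha> r)" using \<alpha>[OF rR] row(1) by metis
    then have mem: "join_of (S (\<alpha> r) n) \<in> ext r" using n by (auto simp: row_def)
    then have "join_of (S (\<alpha> r) n) \<in> M0" using countable_sub_M[OF r(1)] row(2) er by auto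
    moreover from this have "join_of (S (\<alpha> r) n) \<epsilon> F"
      using above regular_open_join_of ro_embed_le_join_of[OF n] by blast
    ultimately show ?thesis using mem by auto
  qed
  \<comment> \<open>\<open>\<forall>r \<in> R. r \<inter> F \<noteq> \<emptyset>\<close>, with \<open>R\<close> and \<open>F\<close> assigned to the variables 0 and 1\<close>
  let ?\<phi> = "All 2 (Neg (And (Mem 2 0) (All 3 (Neg (And (Mem 3 2) (Mem 3 1))))))"
  define e :: "nat \<Rightarrow> 'a" where "e = (\<lambda>_. F)(0 := R)"
  have "range e \<subseteq> M0" using F(1) M0(2) by (auto simp: e_def)
  then have "sat mem M0 e ?\<phi> \<longleftrightarrow> sat mem (H \<theta>) e ?\<phi>"
    using M0(3) unfolding elementary_def by blast
  moreover have "sat mem M0 e ?\<phi>" using hit by (simp add: e_def)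
  ultimately have all: "\<exists>x. x \<epsilon> r \<and> x \<epsilon> F" if "r \<in> H \<theta>" "r \<epsilon> R" for r
    using that by (auto simp: e_def)
  have "\<exists>n. S \<alpha> n \<noteq> {} \<and> join_of (S \<alpha> n) \<epsilon> F" if "\<alpha> \<in> J" for \<alpha>
  proof -
    have "mk (row \<alpha>) \<in> ext R" using R that by blast
    then have "mk (row \<alpha>) \<epsilon> R" by simp
    then obtain x where "x \<in> ext (mk (row \<alpha>))" "x \<epsilon> F"
      using all H_transitive[OF inH(2)] by auto
    then show ?thesis unfolding row(1) by (auto simp: row_def)
  qed
  then obtain N where N: "\<And>\<alpha>. \<alpha> \<in> J \<Longrightarrow> S \<alpha> (N \<alpha>) \<noteq> {} \<and> join_of (S \<alpha> (N \<alpha>)) \<epsilon> F" by metis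
  \<comment> \<open>Pigeonhole: \<open>N\<close> splits the uncountable \<open>J\<close> into
    countably many classes according to the column in which the row meets \<open>F\<close>.\<close>
  have "\<exists>n. uncountable {\<alpha> \<in> J. N \<alpha> = n}"
  proof (rule ccontr)
    assume "\<not> ?thesis"
    then have "countable (\<Union>n. {\<alpha> \<in> J. N \<alpha> = n})" by auto
    moreover have "(\<Union>n. {\<alpha> \<in> J. N \<alpha> = n}) = J" by auto
    ultimately show False using J(2) by simp
  qed
  then obtain n where n: "uncountable {\<alpha> \<in> J. N \<alpha> = n}" by blast
  define K where "K = {\<alpha> \<in> J. N \<alpha> = n}"
  define f where "f \<alpha> = join_of (S \<alpha> n)" for \<alpha>
  have fF: "f \<alpha> \<epsilon> F" and f_nonempty: "ext (f \<alpha>) \<noteq> {}" if "\<alpha> \<in> K" for \<alpha>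
  proof -
    have "\<alpha> \<in> J" "N \<alpha> = n" using that by (auto simp: K_def)
    with N show "f \<alpha> \<epsilon> F" unfolding f_def by blast
    obtain a where "a \<in> S \<alpha> n" using N \<open>\<alpha> \<in> J\<close> \<open>N \<alpha> = n\<close> by blast
    then show "ext (f \<alpha>) \<noteq> {}" unfolding f_def using join_of_nonempty elJ SJ by blast
  qed
  \<comment> \<open>Entries of different rows in one column are disjoint parts of the antichain
    \<open>A\<close>, so their members are pairwise incompatible.\<close>
  have f_disj: "ext (f \<alpha>) \<inter> ext (f \<beta>) = {}" if "\<alpha> \<in> K" "\<beta> \<in> K" "\<alpha> \<noteq> \<beta>" for \<alpha> \<beta>
    unfolding f_def
  proof (rule join_of_disjoint)
    fix a b assume ab: "a \<in> S \<alpha> n" "b \<in> S \<beta> n"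
    have "S \<alpha> n \<inter> S \<beta> n = {}" using disj that by (simp add: K_def)
    then have "a \<noteq> b" using ab by blast
    moreover have "a \<in> ext A" "b \<in> ext A" using ab SJ J(1) by blast+
    ultimately show "\<not> compatible P a b" using incomp by simp
  qed
  \<comment> \<open>Disjoint nonempty sets are different, so the uncountably many indices in
    \<open>K\<close> give uncountably many elements of \<open>F\<close>.\<close>
  have "inj_on f K"
    by (rule inj_onI) (metis f_disj f_nonempty inf.idem)
  then have "uncountable (f ` K)" using n by (simp add: countable_image_inj_eq flip: K_def)
  moreover have "countable (f ` K)"
  proof -
    have sub: "f ` K \<subseteq> ext F" using fF by auto
    have ext: "ext (mk (f ` K)) = f ` K" by (rule ext_mk[OF small_subset[OF small_ext sub]])
    then have mem: "x \<epsilon> mk (f ` K) \<longleftrightarrow> x \<in> f ` K" for x using mem_ext[of x "mk (f ` K)"] by simp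
    have "ba_antichain (RO P) (mk (f ` K))"
      unfolding ba_antichain_def
    proof (intro conjI allI impI)
      fix x assume "x \<epsilon> mk (f ` K)"
      then obtain \<alpha> where "x = f \<alpha>" "\<alpha> \<in> K" unfolding mem by (rule imageE)
      then show "nonzero (RO P) x"
        using f_nonempty[of \<alpha>] regular_open_join_of[of "S \<alpha> n"]
        by (simp add: nonzero_def el_RO is_zero_RO f_def)
    next
      fix x y z assume "x \<epsilon> mk (f ` K) \<and> y \<epsilon> mk (f ` K) \<and> x \<noteq> y \<and> is_meet (RO P) x y z"
      then have xyz: "x \<in> f ` K" "y \<in> f ` K" "x \<noteq> y" "is_meet (RO P) x y z"
        unfolding mem by simp_all
      obtain \<alpha> \<beta> where \<alpha>\<beta>: "\<alpha> \<in> K" "x = f \<alpha>" "\<beta> \<in> K" "y = f \<beta>"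
        using xyz(1,2) by (elim imageE)
      then have "ext x \<inter> ext y = {}" using f_disj xyz(3) by metis
      then show "is_zero (RO P) z" using xyz(4) by (simp only: is_zero_RO is_meet_RO)
    qed
    \<comment> \<open>The condition \<open>q\<close> shows that \<open>P\<close> is nonempty, which
      is what separates zero from one in \<open>RO P\<close>.\<close>
    moreover have "cba (RO P)" using cba_RO elJ[OF q(1)] by blast
    ultimately show ?thesis using no_uncountable[of "RO P" F "mk (f ` K)"] F ext sub by simp
  qed
  ultimately show False by blast
qed

end

theorem theorem5p4:
  fixes mem :: "'v \<Rightarrow> 'v \<Rightarrow> bool" and \<Phi> :: fm
  assumes "membership.zfc_universe mem"
    and "regularity_property \<Phi>"
    and "\<And>B F A. membership.cba mem B \<Longrightarrow> membership.sub mem F B \<Longrightarrow>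
           membership.holds mem \<Phi> F B \<Longrightarrow>
           membership.ext mem A \<subseteq> membership.ext mem F \<Longrightarrow> membership.ba_antichain mem B A \<Longrightarrow>
           countable (membership.ext mem A)"
  shows "\<forall>P. membership.poset mem P \<and> membership.Phi_cc mem \<Phi> P \<longrightarrow> membership.ccc mem P"
proof (intro allI impI, elim conjE)
  fix P assume "membership.poset mem P" and cc: "membership.Phi_cc mem \<Phi> P"
  then interpret poset_universe mem P
    using assms(1) by (simp add: poset_universe_def set_universe_def poset_universe_axioms_def)
  show "membership.ccc mem P" by (rule ccc_if_Phi_cc[OF assms(3) cc])
qed

end
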